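(* Let $W$ be a weight satisfying $(C_1)$, $(C_2)$ and $(C_3)$, let $\omega$ be its associated moment sequence, and let $\Omega=1/\omega$ be the reciprocal of $\omega$. Setting $$h(t) := \frac{W(t)}{\left( \int_0^t W(s) \, ds \right)^2}, \qquad 0<t<1,$$ the following equivalence of norms holds: $$\sum_{n\in \mathbb{Z}} |\widehat{f}(n)|^2 \, \Omega(|n|) \asymp \int_{-\pi}^{\pi}\int_{-\pi}^{\pi} |f(e^{it})-f(e^{is})|^2\, h\left(\frac{|s-t|}{\pi}\right) ds\, dt,$$ for all $f\in \ell^2(\Omega)$ with zero average $\widehat{f}(0)=0$.
   Context: A weight is a non-negative continuously differentiable function $W$ on $(0,1]$ which is integrable on $[0,1]$ with respect to Lebesgue measure. Its associated moment sequence is $\omega(n)=\int_0^1 r^n W(1-r)\,dr$, $n=0,1,2,\dots$. The conditions on $W$ are: $(C_1)$ $W$ is either monotone non-decreasing or monotone non-increasing; $(C_2)$ $\int_0^1 \frac{W(t)}{t}\,dt=+\infty$; $(C_3)$ there is a constant $0<c<2$, depending only on $W$, such that $W(t)\leq c\,W(t/2)$ for all $0<t<1$. $\ell^2(\Omega)$ is the Hilbert space of $f\in L^2(\mathbb{T})$ ($\mathbb{T}$ the unit circle) with $\|f\|_{\ell^2(\Omega)}^2=\sum_{n\in\mathbb{Z}}|\widehat f(n)|^2\Omega(|n|)<\infty$, where $\Omega(n)=1/\omega(n)$. In the double integral, $|s-t|$ denotes the distance from $s$ to $t$ modulo $2\pi$, i.e. the arc length distance in $[0,\pi]$ between $e^{is}$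 and $e^{it}$. $A\asymp B$ means $c_1A\leq B\leq c_2A$ with constants $c_1,c_2>0$ independent of $f$ (they may depend on $W$). *)

theory Defs
  imports "HOL-Analysis.Analysis"
begin

text \<open>
  Weights live on \<open>(0,1]\<close> but are represented by total functions; only the values on
  \<open>(0,1]\<close> matter below.  At the endpoint \<open>1\<close> the derivative is one-sided.
\<close>

definition weight :: "(real \<Rightarrow> real) \<Rightarrow> bool" where
  "weight W \<longleftrightarrow>
     (\<forall>t\<in>{0<..1}. 0 \<le> W t) \<and>
     (\<exists>W'. (\<forall>t\<in>{0<..1}. (W has_real_derivative W' t) (at t within {0<..1})) \<and>
           continuous_on {0<..1} W') \<and>
     integrable (lebesgue_on {0<..1}) W"

definition cond_C1 :: "(real \<Rightarrow> real) \<Rightarrow> bool" where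
  "cond_C1 W \<longleftrightarrow> mono_on {0<..1} W \<or> antimono_on {0<..1} W"

definition cond_C2 :: "(real \<Rightarrow> real) \<Rightarrow> bool" where
  "cond_C2 W \<longleftrightarrow> (\<integral>\<^sup>+ t. ennreal (W t / t) \<partial>lebesgue_on {0<..1}) = \<infinity>"

definition cond_C3 :: "(real \<Rightarrow> real) \<Rightarrow> bool" where
  "cond_C3 W \<longleftrightarrow> (\<exists>c. 0 < c \<and> c < 2 \<and> (\<forall>t. 0 < t \<and> t < 1 \<longrightarrow> W t \<le> c * W (t / 2)))"

text \<open>The point \<open>r = 1\<close>, where \<open>W (1 - r)\<close> is not meaningful, is left out of the integral.\<close>

definition moment :: "(real \<Rightarrow> real) \<Rightarrow> nat \<Rightarrow> real" where
  "moment W n = (LINT r|lebesgue_on {0..<1}. r ^ n * W (1 - r))"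

definition h_kernel :: "(real \<Rightarrow> real) \<Rightarrow> real \<Rightarrow> real" where
  "h_kernel W t = W t / (LINT s|lebesgue_on {0<..t}. W s)\<^sup>2"

text \<open>
  Functions on the unit circle are represented by functions \<open>complex \<Rightarrow> complex\<close> of which only
  the values at the points \<open>cis t\<close> matter; functions that agree almost everywhere are not
  identified.
\<close>

definition L2_circle :: "(complex \<Rightarrow> complex) set" where
  "L2_circle = {f. (\<lambda>t. f (cis t)) \<in> borel_measurable (lebesgue_on {-pi..pi}) \<and>
                   integrable (lebesgue_on {-pi..pi}) (\<lambda>t. (norm (f (cis t)))\<^sup>2)}"

definition fourier_coeff :: "(complex \<Rightarrow> complex) \<Rightarrow> int \<Rightarrow> complex" where
  "fourier_coeff f n =
     (LINT t|lebesgue_on {-pi..pi}. f (cis t) * cis (- of_int n * t)) / (2 * of_real pi)"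

definition weighted_l2 :: "(nat \<Rightarrow> real) \<Rightarrow> (complex \<Rightarrow> complex) set" where
  "weighted_l2 \<Omega> =
     {f \<in> L2_circle. (\<lambda>n::int. (norm (fourier_coeff f n))\<^sup>2 * \<Omega> (nat \<bar>n\<bar>)) summable_on UNIV}"

definition weighted_l2_normsq :: "(nat \<Rightarrow> real) \<Rightarrow> (complex \<Rightarrow> complex) \<Rightarrow> real" where
  "weighted_l2_normsq \<Omega> f = (\<Sum>\<^sub>\<infinity>n::int. (norm (fourier_coeff f n))\<^sup>2 * \<Omega> (nat \<bar>n\<bar>))"

text \<open>The distance from \<open>s\<close> to \<open>t\<close> modulo \<open>2 * pi\<close>.\<close>

definition arc_dist :: "real \<Rightarrow> real \<Rightarrow> real" where
  "arc_dist s t = (INF k::int. \<bar>s - t - 2 * pi * of_int k\<bar>)"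

text \<open>
  The value is an extended non-negative real: the integrand is non-negative for a weight \<open>W\<close>,
  and finiteness of the integral is not presupposed.
\<close>

definition double_integral :: "(real \<Rightarrow> real) \<Rightarrow> (complex \<Rightarrow> complex) \<Rightarrow> ennreal" where
  "double_integral W f =
     (\<integral>\<^sup>+ t. (\<integral>\<^sup>+ s. ennreal ((norm (f (cis t) - f (cis s)))\<^sup>2 * h_kernel W (arc_dist s t / pi))
        \<partial>lebesgue_on {-pi..pi}) \<partial>lebesgue_on {-pi..pi})"

end

theory Submission
  imports Defs
begin

text \<open>
  The translate $f(e^{i(t+u)}) - f(e^{it})$ has Fourier coefficients
  $(e^{inu} - 1) \widehat f(n)$, so Parseval's identity in $t$ and Tonelli's theorem turn the
  double integral into $16 \pi^2 \sum_n |\widehat f(n)|^2 S(|n|)$ with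
  $S(n) = \int_0^1 \sin^2(n \pi x / 2)\, h(x)\, dx$.  It remains to compare $S(n)$ with
  $1/\omega(n)$, and both are comparable to $1/M(1/n)$, where $M(t) = \int_0^t W$.

  For $\omega(n)$ this is a doubling argument: $(C_3)$ gives $M(t) \le 4 (t/x)^\beta M(x)$ for
  $x \le t$ with some $\beta < 2$, and together with $(C_1)$ it gives $x W(x) \le 4 M(x)$.
  For $S(n)$ the point is that $h = (-1/M)'$.  From above, use $\sin^2 \le 1$ on $[1/n, 1]$ and
  $\sin y \le y$ on $[0, 1/n]$, where the growth bound makes the integral converge because
  $\beta < 2$.  From below, if $W$ increases then $M(1/n) \ge 2 M(1/(2n))$ and the interval
  $[1/(2n), 1/n]$ alone suffices; if $W$ decreases then so does $h$, and translation by $1/n$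
  exchanges $\cos^2$ and $\sin^2$, so that $\int_{1/n}^1 h \le 2 S(n)$.
\<close>

subsection \<open>The integrals S(n) and the moments of the weight\<close>

text \<open>The kernel \<open>h\<close> is never integrable at 0: its integral over [a,1] is 1/M(a)
  - 1/M(1), and M(a) tends to 0. Only the factor sin^2 can compensate, and it does so because the
  constant in (C3) is strictly below 2. The lower bound needs two arguments because a decreasing
  weight may have a slowly varying primitive: for W(t) = 1/(t log^2(e^2/t)) one has M(t) =
  1/log(e^2/t), so 1/M changes by log 2 over a dyadic interval while 1/M(1/n) grows like log n. The
  oscillation of sin^2 must then be averaged over all of [1/n,1]. Sums and integrals on the way to
  the double integral take extended nonnegative values, so that they can be interchanged before
  anything is known to be finite. Measurability is a separate obstacle: f is only Lebesgue
  measurable along one period, whereas translates and Tonelli's theorem ask for a Borel function on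
  the line; hence the passage to a periodic Borel version.\<close>

text \<open>
  The value at $0$ is normalised so that \<open>W\<close> can be integrated over closed intervals; the
  constant of $(C_3)$ may be enlarged to be at least $1$.
\<close>
locale regular_weight =
  fixes W :: "real \<Rightarrow> real" and c :: real
  assumes W_0: "W 0 = 0"
    and W_nonneg: "\<And>t. 0 \<le> t \<Longrightarrow> t \<le> 1 \<Longrightarrow> 0 \<le> W t"
    and W_cont: "continuous_on {0<..1} W"
    and W_integrable: "W integrable_on {0..1}"
    and W_mono: "mono_on {0<..1} W \<or> antimono_on {0<..1} W"
    and c: "1 \<le> c" "c < 2"
    and W_doubling: "\<And>t. 0 < t \<Longrightarrow> t < 1 \<Longrightarrow> W t \<le> c * W (t / 2)"
    and W_nontrivial: "\<exists>t. 0 < t \<and> t < 1 \<and> 0 < W t"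
begin

section \<open>The primitive of the weight, and the kernel as a derivative\<close>

definition M :: "real \<Rightarrow> real" where "M t = integral {0..t} W"

definition h :: "real \<Rightarrow> real" where "h t = W t / (M t)\<^sup>2"

lemma W_integrable_sub: "0 \<le> a \<Longrightarrow> b \<le> 1 \<Longrightarrow> W integrable_on {a..b}"
  by (rule integrable_subinterval_real[OF W_integrable]) auto

lemma M_split: "0 \<le> a \<Longrightarrow> a \<le> b \<Longrightarrow> b \<le> 1 \<Longrightarrow> M b = M a + integral {a..b} W"
  unfolding M_def
  by (rule Henstock_Kurzweil_Integration.integral_combine[symmetric]) (auto intro: W_integrable_sub)

lemma M_mono: "0 \<le> a \<Longrightarrow> a \<le> b \<Longrightarrow> b \<le> 1 \<Longrightarrow> M a \<le> M b"
  using M_split[of a b] integral_nonneg[OF W_integrable_sub[of a b]] W_nonneg by auto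

lemma M_nonneg: "0 \<le> t \<Longrightarrow> t \<le> 1 \<Longrightarrow> 0 \<le> M t"
  using M_mono[of 0 t] by (simp add: M_def)

text \<open>A zero of \<open>M\<close> would make \<open>W\<close> vanish near 0, and the iterated
  doubling condition \<open>W s \<le> c ^ k * W (s / 2 ^ k)\<close> would spread this to all of
  (0,1), against \<open>W_nontrivial\<close>.\<close>

lemma M_pos:
  assumes "0 < t" "t \<le> 1"
  shows "0 < M t"
proof (rule ccontr)
  assume "\<not> 0 < M t"
  then have M0: "M t = 0" using M_nonneg[of t] assms by auto
  have Wz: "W s = 0" if "0 < s" "s < t" for s
  proof -
    have "integral {s..t} W = 0"
      using M_split[of s t] M_nonneg[of s] M0 that assms integral_nonneg[OF W_integrable_sub[of s t]] W_nonneg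
      by auto
    moreover have "continuous_on {s..t} W"
      by (rule continuous_on_subset[OF W_cont]) (use that assms in auto)
    ultimately show ?thesis
      using integral_eq_0_iff[of s t W] that assms W_nonneg by auto
  qed
  have "W s = 0" if "0 < s" "s < 1" for s
  proof -
    have *: "W s \<le> c ^ k * W (s / 2 ^ k)" for k
    proof (induction k)
      case (Suc k)
      have "s / 2 ^ k \<le> s" using that by (simp add: divide_le_eq)
      then have "W (s / 2 ^ k) \<le> c * W (s / 2 ^ k / 2)"
        using that by (intro W_doubling) (simp, linarith)
      then have "c ^ k * W (s / 2 ^ k) \<le> c ^ k * (c * W (s / 2 ^ k / 2))"
        using c by (intro mult_left_mono) auto
      then show ?case using Suc by (simp add: field_simps)
    qed simp
    have "(\<lambda>k. s / 2 ^ k) \<longlonglongrightarrow> 0"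
      by real_asymp
    then have "eventually (\<lambda>k. s / 2 ^ k < t) sequentially"
      using assms(1) by (rule order_tendstoD)
    then obtain k where "s / 2 ^ k < t" by (auto simp: eventually_sequentially)
    then have "W (s / 2 ^ k) = 0" using that by (intro Wz) auto
    then show ?thesis using *[of k] W_nonneg[of s] that by auto
  qed
  then show False using W_nontrivial by force
qed

lemma M_continuous: "continuous_on {0..1} M"
  using indefinite_integral_continuous_1[OF W_integrable] by (simp add: M_def[abs_def])

lemma M_deriv:
  assumes "0 < t" "t \<le> 1"
  shows "(M has_real_derivative W t) (at t within {0<..1})"
proof -
  have eq: "{0..1} - {0} = {0<..1::real}" by auto
  have "((\<lambda>u. integral {0..u} W) has_vector_derivative W t) (at t within ({0..1} - {0}))"
    using W_cont assms
    by (intro integral_has_vector_derivative_continuous_at W_integrable)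
       (auto simp: eq continuous_on_eq_continuous_within)
  then show ?thesis
    by (simp add: eq M_def[abs_def] has_real_derivative_iff_has_vector_derivative)
qed

lemma h_nonneg: "0 \<le> t \<Longrightarrow> t \<le> 1 \<Longrightarrow> 0 \<le> h t"
  by (simp add: h_def W_nonneg)

lemma h_continuous: "continuous_on {0<..1} h"
proof -
  have "M t \<noteq> 0" if "t \<in> {0<..1}" for t
    using M_pos[of t] that by auto
  then show ?thesis unfolding h_def
    by (intro continuous_intros W_cont continuous_on_subset[OF M_continuous]) auto
qed

lemma h_has_integral:
  assumes "0 < a" "a \<le> b" "b \<le> 1"
  shows "(h has_integral (1 / M a - 1 / M b)) {a..b}"
proof -
  have "((\<lambda>t. - 1 / M t) has_vector_derivative h t) (at t within {a..b})" if "t \<in> {a..b}" for t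
  proof -
    have t: "0 < t" "t \<le> 1" using that assms by auto
    have "(M has_real_derivative W t) (at t within {a..b})"
      by (rule DERIV_subset[OF M_deriv[OF t]]) (use assms in auto)
    then have "((\<lambda>t. - 1 / M t) has_real_derivative h t) (at t within {a..b})"
      using M_pos[OF t] by (auto intro!: derivative_eq_intros simp: h_def power2_eq_square)
    then show ?thesis by (simp add: has_real_derivative_iff_has_vector_derivative)
  qed
  from fundamental_theorem_of_calculus[OF assms(2) this] show ?thesis
    by simp
qed

lemma h_nn_integral:
  assumes "0 < a" "a \<le> b" "b \<le> 1"
  shows "(\<integral>\<^sup>+x. ennreal (h x) * indicator {a..b} x \<partial>lborel) = ennreal (1 / M a - 1 / M b)"
  by (rule nn_integral_has_integral_lebesgue'[OF _ h_has_integral]) (use assms h_nonneg in auto)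

text \<open>Nothing is assumed about \<open>W\<close> outside [0,1]; the indicator cuts down to the
  set where continuity yields measurability.\<close>

lemma h_borel: "(\<lambda>x. ennreal (h x) * indicator {0<..1} x) \<in> borel_measurable borel"
proof -
  have "(\<lambda>x. indicator {0<..1} x *\<^sub>R h x) \<in> borel_measurable borel"
    by (rule borel_measurable_continuous_on_indicator[OF _ h_continuous]) simp
  then have "(\<lambda>x. ennreal (indicator {0<..1} x *\<^sub>R h x)) \<in> borel_measurable borel"
    by measurable
  also have "(\<lambda>x. ennreal (indicator {0<..1} x *\<^sub>R h x)) = (\<lambda>x. ennreal (h x) * indicator {0<..1} x)"
    by (auto simp: fun_eq_iff indicator_def)
  finally show ?thesis .
qed

section \<open>Doubling and growth of the primitive\<close>

lemma M_doubling:
  assumes "0 \<le> t" "t \<le> 1 / 2"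
  shows "M (2 * t) \<le> 2 * c * M t"
proof -
  have "(W has_integral M (2 * t)) {0..2 * t}"
    unfolding M_def by (rule integrable_integral[OF W_integrable_sub]) (use assms in auto)
  from has_integral_stretch_real[OF this, of 2]
  have "((\<lambda>x. W (2 * x)) has_integral (M (2 * t) / 2)) ((\<lambda>x. x / 2) ` {0..2 * t})" by simp
  also have "(\<lambda>x. x / 2) ` {0..2 * t} = {0..t}"
    by auto
  \<comment> \<open>On the open interval 2x stays strictly between 0 and 1, where the doubling
    condition is available.\<close>
  finally have 1: "((\<lambda>x. W (2 * x)) has_integral (M (2 * t) / 2)) {0<..<t}"
    by (simp add: has_integral_Icc_iff_Ioo)
  have "(W has_integral M t) {0..t}"
    unfolding M_def by (rule integrable_integral[OF W_integrable_sub]) (use assms in auto)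
  then have 2: "((\<lambda>x. c * W x) has_integral (c * M t)) {0<..<t}"
    by (simp add: has_integral_Icc_iff_Ioo has_integral_mult_right)
  have "M (2 * t) / 2 \<le> c * M t"
    by (rule has_integral_le[OF 1 2]) (use assms W_doubling[of "2 * x" for x] in auto)
  then show ?thesis by simp
qed

lemma M_growth_power:
  assumes "0 < x" "0 < t" "t \<le> 1" "x \<le> 1" "t \<le> 2 ^ k * x"
  shows "M t \<le> (2 * c) ^ k * M x"
  using assms
proof (induction k arbitrary: t)
  case 0
  then show ?case by (simp add: M_mono)
next
  case (Suc k)
  have "M t \<le> 2 * c * M (t / 2)" using M_doubling[of "t / 2"] Suc by simp
  also have "M (t / 2) \<le> (2 * c) ^ k * M x" using Suc by (intro Suc.IH) auto
  finally show ?case using c by (simp add: mult.assoc)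
qed

text \<open>Chosen so that \<open>2 powr \<beta>\<close> is the factor \<open>2 * c\<close> of
  \<open>M_doubling\<close>: the bounds 1 and 2 for \<open>c\<close> become 1 and 2 for
  \<beta>.\<close>

definition \<beta> :: real where "\<beta> = log 2 (2 * c)"

lemma \<beta>: "1 \<le> \<beta>" "\<beta> < 2"
proof -
  show "1 \<le> \<beta>" using c by (simp add: \<beta>_def le_log_iff)
  have "log 2 (2 * c) < log 2 (2 ^ 2)" using c by (subst log_less_cancel_iff) auto
  also have "log 2 (2 ^ 2) = (2::real)" by (subst log_nat_power) auto
  finally show "\<beta> < 2" by (simp add: \<beta>_def)
qed

text \<open>Take the least number \<open>k\<close> of doublings that carries \<open>x\<close> to
  \<open>t\<close> or beyond. Rounding log2(t/x) up costs at most one more factor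
  \<open>2 * c\<close>, which is the 4.\<close>

lemma M_growth:
  assumes "0 < x" "x \<le> t" "t \<le> 1"
  shows "M t \<le> 4 * (t / x) powr \<beta> * M x"
proof -
  define k where "k = nat \<lceil>log 2 (t / x)\<rceil>"
  have l0: "0 \<le> log 2 (t / x)" using assms by simp
  have k: "log 2 (t / x) \<le> real k" "real k \<le> log 2 (t / x) + 1"
    unfolding k_def using l0 by linarith+
  have "t / x = 2 powr log 2 (t / x)" using assms by simp
  also have "\<dots> \<le> 2 powr real k" using k by (intro powr_mono) auto
  also have "\<dots> = 2 ^ k" by (simp add: powr_realpow)
  finally have "t \<le> 2 ^ k * x" using assms by (simp add: field_simps)
  then have "M t \<le> (2 * c) ^ k * M x" using assms by (intro M_growth_power) auto
  also have "(2 * c) ^ k = (2 powr \<beta>) ^ k" using c by (simp add: \<beta>_def)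
  also have "\<dots> = 2 powr (\<beta> * real k)" by (simp add: powr_powr powr_realpow[symmetric])
  also have "\<dots> \<le> 2 powr (\<beta> * (log 2 (t / x) + 1))"
    using k \<beta> by (intro powr_mono mult_left_mono) auto
  also have "\<dots> = (2 powr log 2 (t / x)) powr \<beta> * 2 powr \<beta>"
    by (simp add: algebra_simps powr_add powr_powr del: powr_log_cancel)
  also have "\<dots> = (t / x) powr \<beta> * (2 * c)" using assms c by (simp add: \<beta>_def)
  also have "\<dots> \<le> (t / x) powr \<beta> * 4" using c by (intro mult_left_mono) auto
  finally show ?thesis
    using M_nonneg[of x] assms by (simp add: mult_right_mono mult.commute)
qed

lemma integral_ge_const:
  assumes "0 \<le> a" "a \<le> b" "b \<le> 1" "\<And>s. a < s \<Longrightarrow> s < b \<Longrightarrow> m \<le> W s"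
  shows "(b - a) * m \<le> integral {a..b} W"
proof -
  have "((\<lambda>_. m) has_integral ((b - a) * m)) {a<..<b}"
    using has_integral_const_real[of m a b] assms by (simp add: has_integral_Icc_iff_Ioo)
  moreover have "(W has_integral integral {a..b} W) {a<..<b}"
    using integrable_integral[OF W_integrable_sub[of a b]] assms by (simp add: has_integral_Icc_iff_Ioo)
  ultimately show ?thesis by (rule has_integral_le) (use assms in auto)
qed

text \<open>An increasing \<open>W\<close> is at least W(x/2) on the right half of (0,x), and (C3)
  leads back from x/2 to x; each of the two steps costs a factor 2. A decreasing \<open>W\<close> is
  at least W(x) on all of (0,x). Upper estimates may therefore replace W(x) by a multiple of
  M(x)/x.\<close>

lemma W_le_M:
  assumes "0 < x" "x < 1"
  shows "x * W x \<le> 4 * M x"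
  using W_mono
proof
  assume m: "mono_on {0<..1} W"
  have "(x - x / 2) * W (x / 2) \<le> integral {x/2..x} W"
    by (rule integral_ge_const) (use assms in \<open>auto intro!: mono_onD[OF m]\<close>)
  also have "\<dots> \<le> M x" using M_split[of "x / 2" x] M_nonneg[of "x / 2"] assms by auto
  finally have 1: "x * W (x / 2) \<le> 2 * M x" by simp
  have "x * W x \<le> x * (c * W (x / 2))"
    using W_doubling[OF assms] assms by (intro mult_left_mono) auto
  also have "\<dots> = c * (x * W (x / 2))" by simp
  also have "\<dots> \<le> 2 * (2 * M x)"
    using mult_mono[of c 2 "x * W (x / 2)" "2 * M x"] 1 c assms W_nonneg[of "x / 2"] by simp
  finally show ?thesis by simp
next
  assume m: "antimono_on {0<..1} W"
  have "(x - 0) * W x \<le> integral {0..x} W"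
    by (rule integral_ge_const) (use assms m in \<open>auto simp: monotone_on_def\<close>)
  then show ?thesis using M_nonneg[of x] assms by (simp add: M_def)
qed

section \<open>Upper bound for the integrals S(n)\<close>

definition S :: "nat \<Rightarrow> ennreal" where
  "S n = (\<integral>\<^sup>+x. ennreal ((sin (real n * pi * x / 2))\<^sup>2 * h x) * indicator {0<..<1} x \<partial>lborel)"

text \<open>The sine supplies x^2, \<open>W_le_M\<close> trades x W(x) for M(x), and
  \<open>M_growth\<close> trades 1/M(x) for a multiple of (t/x)^\<beta> / M(t); the 16 is 4 from
  each. The remaining exponent \<open>1 - \<beta>\<close> exceeds -1, which is integrability at
  0.\<close>

lemma sin_h_le:
  assumes "0 < x" "x \<le> t" "x < 1" "t \<le> 1"
  shows "(sin (r * x))\<^sup>2 * h x \<le> 16 * r\<^sup>2 * t powr \<beta> / M t * x powr (1 - \<beta>)"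
proof -
  have x: "0 < M x" "0 < M t" using M_pos assms by auto
  have "(sin (r * x))\<^sup>2 \<le> (r * x)\<^sup>2"
    using abs_sin_x_le_abs_x[of "r * x"] by (metis abs_le_square_iff)
  then have "(sin (r * x))\<^sup>2 * h x \<le> (r * x)\<^sup>2 * h x"
    using h_nonneg assms by (intro mult_right_mono) auto
  also have "\<dots> = r\<^sup>2 * x * (x * W x) / (M x)\<^sup>2" by (simp add: h_def power2_eq_square)
  also have "\<dots> \<le> r\<^sup>2 * x * (4 * M x) / (M x)\<^sup>2"
    using W_le_M[of x] assms by (intro divide_right_mono mult_left_mono) auto
  also have "\<dots> = 4 * r\<^sup>2 * x / M t * (M t / M x)" using x by (simp add: power2_eq_square)
  also have "\<dots> \<le> 4 * r\<^sup>2 * x / M t * (4 * (t / x) powr \<beta>)"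
    using M_growth[of x t] x assms by (intro mult_left_mono) (auto simp: divide_le_eq)
  also have "\<dots> = 16 * r\<^sup>2 * t powr \<beta> / M t * (x / x powr \<beta>)"
    using assms by (simp add: powr_divide)
  also have "x / x powr \<beta> = x powr (1 - \<beta>)" using assms by (simp add: powr_diff)
  finally show ?thesis .
qed

text \<open>With r = n pi / 2 and t = 1/n the factor 16 r^2 t^2 is 4 pi^2, and 2 - \<beta> comes
  from integrating x^(1 - \<beta>) over [0,t]. The summand 1 accounts for [t,1], where the integral
  of \<open>h\<close> telescopes.\<close>

lemma S_upper:
  assumes "n \<ge> 1"
  shows "S n \<le> ennreal ((4 * pi\<^sup>2 / (2 - \<beta>) + 1) / M (1 / real n))"
proof -
  define t where "t = 1 / real n"
  define r where "r = real n * pi / 2"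
  have t: "0 < t" "t \<le> 1" using assms by (auto simp: t_def)
  have Mt: "0 < M t" using M_pos t by auto
  define K where "K = 16 * r\<^sup>2 * t powr \<beta> / M t"
  have K0: "0 \<le> K" using Mt by (simp add: K_def)
  have "S n \<le> (\<integral>\<^sup>+x. ennreal (K * x powr (1 - \<beta>)) * indicator {0..t} x + ennreal (h x) * indicator {0<..1} x * indicator {t..1} x \<partial>lborel)"
    unfolding S_def
  proof (rule nn_integral_mono)
    fix x :: real
    show "ennreal ((sin (real n * pi * x / 2))\<^sup>2 * h x) * indicator {0<..<1} x
      \<le> ennreal (K * x powr (1 - \<beta>)) * indicator {0..t} x + ennreal (h x) * indicator {0<..1} x * indicator {t..1} x"
    proof (cases "0 < x \<and> x < 1")
      case True
      show ?thesis
      proof (cases "x \<le> t")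
        case le: True
        have "(sin (real n * pi * x / 2))\<^sup>2 * h x \<le> K * x powr (1 - \<beta>)"
          using sin_h_le[of x t r] True le t by (simp add: K_def r_def algebra_simps)
        then show ?thesis using True le
          by (auto simp: indicator_def intro: add_increasing2 ennreal_leI)
      next
        case False
        have "(sin (real n * pi * x / 2))\<^sup>2 \<le> 1" by (simp add: abs_square_le_1)
        then have "(sin (real n * pi * x / 2))\<^sup>2 * h x \<le> 1 * h x"
          using h_nonneg[of x] True by (intro mult_right_mono) auto
        then show ?thesis using True False by (auto simp: indicator_def intro!: ennreal_leI)
      qed
    qed auto
  qed
  also have "\<dots> = (\<integral>\<^sup>+x. ennreal (K * x powr (1 - \<beta>)) * indicator {0..t} x \<partial>lborel) + (\<integral>\<^sup>+x. ennreal (h x) * indicator {0<..1} x * indicator {t..1} x \<partial>lborel)"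
    using h_borel by (intro nn_integral_add) auto
  also have "(\<integral>\<^sup>+x. ennreal (K * x powr (1 - \<beta>)) * indicator {0..t} x \<partial>lborel) = ennreal (K * (t powr (1 - \<beta> + 1) / (1 - \<beta> + 1)))"
    using K0 t \<beta> by (intro nn_integral_has_integral_lebesgue' has_integral_mult_right has_integral_powr_from_0) auto
  also have "(\<integral>\<^sup>+x. ennreal (h x) * indicator {0<..1} x * indicator {t..1} x \<partial>lborel) = (\<integral>\<^sup>+x. ennreal (h x) * indicator {t..1} x \<partial>lborel)"
    using t by (intro nn_integral_cong) (auto simp: indicator_def)
  also have "\<dots> = ennreal (1 / M t - 1 / M 1)" using t by (intro h_nn_integral) auto
  also have "\<dots> \<le> ennreal (1 / M t)" using M_pos[of 1] by (intro ennreal_leI) auto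
  also have "ennreal (K * (t powr (1 - \<beta> + 1) / (1 - \<beta> + 1))) + ennreal (1 / M t)
      = ennreal (K * (t powr (1 - \<beta> + 1) / (1 - \<beta> + 1)) + 1 / M t)"
    using K0 Mt \<beta> by (intro ennreal_plus[symmetric]) auto
  also have "K * (t powr (1 - \<beta> + 1) / (1 - \<beta> + 1)) = 16 * r\<^sup>2 * (t powr \<beta> * t powr (2 - \<beta>)) / ((2 - \<beta>) * M t)"
    by (simp add: K_def mult_ac)
  also have "t powr \<beta> * t powr (2 - \<beta>) = t\<^sup>2" 
    using t by (simp flip: powr_add)
  also have "16 * r\<^sup>2 * t\<^sup>2 / ((2 - \<beta>) * M t) = (4 * pi\<^sup>2 / (2 - \<beta>)) / M t"
    using assms by (simp add: r_def t_def power_divide power_mult_distrib)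
  finally show ?thesis by (simp add: t_def add_divide_distrib add_left_mono)
qed

section \<open>Lower bounds for S(n)\<close>

lemma S_ge:
  assumes "0 < a" "a \<le> b" "b \<le> 1" "0 \<le> d" "\<And>x. a \<le> x \<Longrightarrow> x \<le> b \<Longrightarrow> d \<le> (sin (real n * pi * x / 2))\<^sup>2"
  shows "ennreal (d * (1 / M a - 1 / M b)) \<le> S n"
proof -
  have "ennreal (d * (1 / M a - 1 / M b)) = ennreal d * (\<integral>\<^sup>+x. ennreal (h x) * indicator {a..b} x \<partial>lborel)"
    using assms by (simp add: h_nn_integral ennreal_mult')
  also have "\<dots> = ennreal d * (\<integral>\<^sup>+x. ennreal (h x) * indicator {0<..1} x * indicator {a..b} x \<partial>lborel)"
  proof -
    have "indicator {0<..1} x * indicator {a..b} x = (indicator {a..b} x :: ennreal)" for x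
      using assms(1,3) by (auto simp: indicator_def)
    then show ?thesis by (simp only: mult.assoc)
  qed
  also have "\<dots> = (\<integral>\<^sup>+x. ennreal d * (ennreal (h x) * indicator {0<..1} x * indicator {a..b} x) \<partial>lborel)"
    using h_borel by (intro nn_integral_cmult[symmetric]) auto
  also have "\<dots> \<le> S n" unfolding S_def
  proof (rule nn_integral_mono_AE)
    show "AE x in lborel. ennreal d * (ennreal (h x) * indicator {0<..1} x * indicator {a..b} x)
      \<le> ennreal ((sin (real n * pi * x / 2))\<^sup>2 * h x) * indicator {0<..<1} x"
      using AE_lborel_singleton[of 1]
    proof eventually_elim
      case (elim x)
      show ?case
      proof (cases "a \<le> x \<and> x \<le> b")
        case True
        then have x: "0 < x" "x < 1" using assms elim by auto
        have "d * h x \<le> (sin (real n * pi * x / 2))\<^sup>2 * h x"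
          using True assms(5)[of x] h_nonneg[of x] x by (intro mult_right_mono) auto
        then show ?thesis
          using True x assms(4) by (auto simp: indicator_def ennreal_mult'[symmetric] intro: ennreal_leI)
      qed (auto simp: indicator_def)
    qed
  qed
  finally show ?thesis .
qed

text \<open>On [1/(2n), 1/n] the argument of the sine runs from pi/4 to pi/2, which gives the 1/2.
  Comparing W(x) with W(x + a) gives 2 M(a) \<le> M(2a), so 1/M(a) - 1/M(2a) is still at least
  1/M(2a).\<close>

lemma S_lower_mono:
  assumes m: "mono_on {0<..1} W" and n: "n \<ge> 1"
  shows "ennreal (1 / 2 / M (1 / real n)) \<le> S n"
proof -
  define a b where "a = 1 / (2 * real n)" and "b = 1 / real n"
  have ab: "0 < a" "a \<le> b" "b \<le> 1" "b = 2 * a" using n by (auto simp: a_def b_def field_simps)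
  have le: "1 / 2 \<le> (sin (real n * pi * x / 2))\<^sup>2" if "a \<le> x" "x \<le> b" for x
  proof -
    let ?y = "real n * pi * x / 2"
    have "1 / 2 \<le> real n * x" "real n * x \<le> 1"
      using that n by (auto simp: a_def b_def field_simps)
    then have "pi * (1 / 2) \<le> pi * (real n * x)" "pi * (real n * x) \<le> pi * 1"
      by (intro mult_left_mono; simp)+
    then have "pi / 4 \<le> ?y" "?y \<le> pi / 2" by (auto simp: algebra_simps)
    then have "sin (pi / 4) \<le> sin ?y" by (intro sin_monotone_2pi_le) auto
    then have "(sin (pi / 4))\<^sup>2 \<le> (sin ?y)\<^sup>2" by (intro power_mono) (auto simp: sin_45)
    then show ?thesis by (simp add: sin_45 power_divide)
  qed
  have M2: "2 * M a \<le> M b"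
  proof -
    have "M a \<le> integral {a..b} W"
    proof -
      have 1: "((\<lambda>x. W (1 * x + a)) has_integral (integral {a..b} W)) {0..a}"
      proof -
        have "(W has_integral integral {a..b} W) (cbox a b)"
          using integrable_integral[OF W_integrable_sub[of a b]] ab by simp
        from has_integral_affinity[OF this, of 1 a]
        have "((\<lambda>x. W (1 * x + a)) has_integral (integral {a..b} W)) ((\<lambda>x. x - a) ` {a..b})" by simp
        moreover have "(\<lambda>x. x - a) ` {a..b} = {0..a}"
          using ab by (auto simp: image_iff intro!: bexI[of _ "x + a" for x])
        ultimately show ?thesis by (simp only:)
      qed
      have 2: "(W has_integral M a) {0..a}"
        unfolding M_def by (rule integrable_integral[OF W_integrable_sub]) (use ab in auto)
      show ?thesis
      proof (rule has_integral_le[OF 2 1])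
        fix x assume x: "x \<in> {0..a}"
        \<comment> \<open>Monotonicity says nothing at 0; there the normalisation \<open>W_0\<close>
          decides.\<close>
        show "W x \<le> W (1 * x + a)"
        proof (cases "x = 0")
          case True
          then show ?thesis using W_0 W_nonneg[of a] ab by auto
        next
          case False
          then show ?thesis using x ab by (auto intro!: mono_onD[OF m])
        qed
      qed
    qed
    then show ?thesis using M_split[of a b] ab by auto
  qed
  have pos: "0 < M a" "0 < M b" using M_pos ab by auto
  have "1 / M a \<ge> 2 / M b" using M2 pos by (simp add: field_simps)
  then have "1 / 2 / M b \<le> 1 / 2 * (1 / M a - 1 / M b)" by (simp add: field_simps)
  then have "ennreal (1 / 2 / M b) \<le> ennreal (1 / 2 * (1 / M a - 1 / M b))" by (rule ennreal_leI)
  also have "\<dots> \<le> S n" by (rule S_ge) (use ab le in auto)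
  finally show ?thesis by (simp add: b_def)
qed

text \<open>A decreasing \<open>W\<close> that is positive at some e \<le> 1/n is bounded below on
  (0,e], so \<open>h\<close> has positive integral over [e/2, e]. The sine is increasing there, its
  argument not exceeding pi/2, so its value at e/2 is a positive lower bound.\<close>

lemma S_pos_antimono:
  assumes m: "antimono_on {0<..1} W" and n: "n \<ge> 1"
  obtains d where "d > 0" "ennreal d \<le> S n"
proof -
  define b where "b = 1 / real n"
  have b: "0 < b" "b \<le> 1" using n by (auto simp: b_def)
  have "\<exists>e. 0 < e \<and> e \<le> b \<and> 0 < W e"
  proof (rule ccontr)
    assume "\<not> ?thesis"
    then have z: "W e = 0" if "0 \<le> e" "e \<le> b" for e
      using that b W_nonneg[of e] W_0 by (cases "e = 0") force+
    have "M b = integral {0..b} (\<lambda>_. 0::real)" unfolding M_def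
      by (rule Henstock_Kurzweil_Integration.integral_cong) (use z in auto)
    then show False using M_pos[of b] b by simp
  qed
  then obtain e where e: "0 < e" "e \<le> b" "0 < W e" by blast
  have "(e - e / 2) * W e \<le> integral {e/2..e} W"
    by (rule integral_ge_const) (use e b m in \<open>auto simp: monotone_on_def\<close>)
  then have "e / 2 * W e \<le> integral {e/2..e} W" by simp
  moreover have "0 < e / 2 * W e" using e by simp
  ultimately have "0 < integral {e/2..e} W" by linarith
  then have "M (e / 2) < M e" using M_split[of "e / 2" e] e b by auto
  then have pos: "0 < 1 / M (e / 2) - 1 / M e"
    using M_pos[of e] M_pos[of "e / 2"] e b by (simp add: field_simps)
  define y where "y = real n * pi * (e / 2) / 2"
  have "real n * e \<le> 1" using e n by (simp add: b_def field_simps)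
  have le: "(sin y)\<^sup>2 \<le> (sin (real n * pi * x / 2))\<^sup>2" if "e / 2 \<le> x" "x \<le> e" for x
  proof -
    have "real n * pi * (e / 2) \<le> real n * pi * x" using that by (intro mult_left_mono) auto
    then have "y \<le> real n * pi * x / 2" by (simp add: y_def mult_ac)
    moreover have "real n * x \<le> 1"
      using mult_left_mono[of x e "real n"] that \<open>real n * e \<le> 1\<close> by simp
    then have "pi * (real n * x) \<le> pi * 1" by (intro mult_left_mono) auto
    then have "real n * pi * x / 2 \<le> pi / 2" by (simp add: algebra_simps)
    moreover have "0 \<le> y" using e by (simp add: y_def)
    moreover have "0 < pi" by simp
    ultimately show ?thesis by (intro power_mono sin_monotone_2pi_le sin_ge_zero; linarith)
  qed
  have "pi * (real n * e) \<le> pi * 1" using \<open>real n * e \<le> 1\<close> by (intro mult_left_mono) auto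
  moreover have "0 < pi * (real n * e)" using e n by simp
  ultimately have "0 < y" "y < pi" by (auto simp: y_def algebra_simps)
  then have sy: "0 < (sin y)\<^sup>2" using sin_gt_zero[of y] by simp
  have "ennreal ((sin y)\<^sup>2 * (1 / M (e / 2) - 1 / M e)) \<le> S n"
    by (rule S_ge) (use e b le in auto)
  with sy pos show ?thesis by (intro that) auto
qed

text \<open>
  Since $1/M(1)$ is subtracted, this is conclusive only for large $n$; for the others it is
  enough that $S(n) > 0$.
\<close>
lemma S_cos_shift_antimono:
  assumes m: "antimono_on {0<..1} W" and n: "n \<ge> 1"
  shows "ennreal (1 / M (1 / real n) - 1 / M 1) \<le> 2 * S n"
proof -
  define b where "b = 1 / real n"
  have b: "0 < b" "b \<le> 1" using n by (auto simp: b_def)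
  define H where "H x = ennreal (h x) * indicator {0<..1} x" for x
  have [measurable]: "H \<in> borel_measurable borel" unfolding H_def by (rule h_borel)
  have h_mono: "h y \<le> h x" if "0 < x" "x \<le> y" "y \<le> 1" for x y
    unfolding h_def using that M_mono[of x y] M_pos[of x] W_nonneg[of x] m
    by (intro frac_le power_mono) (auto simp: monotone_on_def)
  have "ennreal (1 / M b - 1 / M 1) = (\<integral>\<^sup>+x. ennreal (h x) * indicator {b..1} x \<partial>lborel)"
    using b by (simp add: h_nn_integral)
  also have "\<dots> = (\<integral>\<^sup>+x. ennreal ((sin (real n * pi * x / 2))\<^sup>2) * H x * indicator {b..<1} x
      + ennreal ((cos (real n * pi * x / 2))\<^sup>2) * H x * indicator {b..<1} x \<partial>lborel)"
  proof (rule nn_integral_cong_AE)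
    show "AE x in lborel. ennreal (h x) * indicator {b..1} x = ennreal ((sin (real n * pi * x / 2))\<^sup>2) * H x * indicator {b..<1} x
      + ennreal ((cos (real n * pi * x / 2))\<^sup>2) * H x * indicator {b..<1} x"
      using AE_lborel_singleton[of 1]
    proof eventually_elim
      case (elim x)
      have "ennreal ((sin (real n * pi * x / 2))\<^sup>2) * H x + ennreal ((cos (real n * pi * x / 2))\<^sup>2) * H x = H x"
        by (simp flip: distrib_right ennreal_plus)
      then show ?case using elim b by (auto simp: indicator_def H_def)
    qed
  qed
  also have "\<dots> = (\<integral>\<^sup>+x. ennreal ((sin (real n * pi * x / 2))\<^sup>2) * H x * indicator {b..<1} x \<partial>lborel)
      + (\<integral>\<^sup>+x. ennreal ((cos (real n * pi * x / 2))\<^sup>2) * H x * indicator {b..<1} x \<partial>lborel)"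
    by (intro nn_integral_add) auto
  also have "(\<integral>\<^sup>+x. ennreal ((sin (real n * pi * x / 2))\<^sup>2) * H x * indicator {b..<1} x \<partial>lborel) \<le> S n"
    unfolding S_def using b by (intro nn_integral_mono) (auto simp: indicator_def H_def ennreal_mult')
  also have "(\<integral>\<^sup>+x. ennreal ((cos (real n * pi * x / 2))\<^sup>2) * H x * indicator {b..<1} x \<partial>lborel)
     = (\<integral>\<^sup>+x. ennreal ((cos (real n * pi * (b + 1 * x) / 2))\<^sup>2) * H (b + 1 * x) * indicator {b..<1} (b + 1 * x) \<partial>lborel)"
    by (subst nn_integral_real_affine[of _ 1 b]) auto
  also have "\<dots> \<le> S n"
    unfolding S_def
  proof (rule nn_integral_mono_AE)
    \<comment> \<open>The translated interval [b,1) starts at x = 0, a point outside the domain of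
      integration of \<open>S\<close>; hence the comparison almost everywhere.\<close>
    show "AE x in lborel. ennreal ((cos (real n * pi * (b + 1 * x) / 2))\<^sup>2) * H (b + 1 * x) * indicator {b..<1} (b + 1 * x)
       \<le> ennreal ((sin (real n * pi * x / 2))\<^sup>2 * h x) * indicator {0<..<1} x"
      using AE_lborel_singleton[of 0]
    proof eventually_elim
      case (elim x)
      show ?case
      proof (cases "0 < x \<and> b + x < 1")
        case True
        have "real n * pi * (b + 1 * x) / 2 = real n * pi * x / 2 + pi / 2"
          using n by (simp add: b_def field_simps)
        then have "cos (real n * pi * (b + 1 * x) / 2) = - sin (real n * pi * x / 2)"
          by (simp only: cos_add) simp
        moreover have "(sin (real n * pi * x / 2))\<^sup>2 * h (b + x) \<le> (sin (real n * pi * x / 2))\<^sup>2 * h x"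
          using h_mono[of x "b + x"] True b by (intro mult_left_mono) auto
        ultimately show ?thesis
          using True b by (auto simp: indicator_def H_def ennreal_mult'[symmetric] intro: ennreal_leI)
      qed (use elim in \<open>auto simp: indicator_def\<close>)
    qed
  qed
  finally show ?thesis by (simp add: b_def mult_2)
qed

text \<open>For decreasing \<open>W\<close>, M(1/n) tends to 0, so from some \<open>N\<close> on the
  subtracted 1/M(1) is at most half of 1/M(1/n); the other half, divided by the 2 of
  \<open>S_cos_shift_antimono\<close>, gives 1/4. Finitely many n remain, each with its own positive
  constant, and a minimum serves them all.\<close>

lemma S_lower:
  obtains d where "d > 0" "\<And>n. n \<ge> 1 \<Longrightarrow> ennreal (d / M (1 / real n)) \<le> S n"
  using W_mono
proof
  assume "mono_on {0<..1} W"
  then show ?thesis using S_lower_mono that[of "1 / 2"] by auto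
next
  assume m: "antimono_on {0<..1} W"
  have "(M \<longlongrightarrow> M 0) (at 0 within {0..1})"
    using M_continuous by (simp add: continuous_on_def)
  moreover have "filterlim (\<lambda>n. 1 / real n) (at 0 within {0..1}) sequentially"
    unfolding filterlim_at
    by (auto simp: eventually_sequentially intro!: exI[of _ 1] lim_1_over_n)
  ultimately have "(\<lambda>n. M (1 / real n)) \<longlonglongrightarrow> M 0" by (rule filterlim_compose)
  then have "eventually (\<lambda>n. M (1 / real n) < M 1 / 2) sequentially"
    using M_pos[of 1] by (intro order_tendstoD) (auto simp: M_def)
  then obtain N where N: "\<And>n. n \<ge> N \<Longrightarrow> M (1 / real n) < M 1 / 2"
    by (auto simp: eventually_sequentially)
  have Mn: "0 < M (1 / real n)" if "n \<ge> 1" for n using that by (intro M_pos) auto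
  have large: "ennreal (1 / 4 / M (1 / real n)) \<le> S n" if "n \<ge> N" "n \<ge> 1" for n
  proof -
    have "1 / M 1 \<le> 1 / 2 / M (1 / real n)"
      using N[OF that(1)] Mn[OF that(2)] M_pos[of 1] by (simp add: field_simps)
    then have "2 * (1 / 4 / M (1 / real n)) \<le> 1 / M (1 / real n) - 1 / M 1" by simp
    then have "ennreal (2 * (1 / 4 / M (1 / real n))) \<le> 2 * S n"
      using S_cos_shift_antimono[OF m that(2)] by (meson ennreal_leI order_trans)
    moreover have "ennreal (2 * (1 / 4 / M (1 / real n))) = 2 * ennreal (1 / 4 / M (1 / real n))"
      by (subst ennreal_mult') (simp_all del: divide_divide_eq_left)
    ultimately have "2 * ennreal (1 / 4 / M (1 / real n)) \<le> 2 * S n"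
      by (simp only:)
    then show ?thesis by (subst (asm) ennreal_mult_le_mult_iff) auto
  qed
  have "\<exists>d>0. ennreal (d / M (1 / real n)) \<le> S n" if "n \<ge> 1" for n
  proof -
    obtain d where "d > 0" "ennreal d \<le> S n" using S_pos_antimono[OF m \<open>n \<ge> 1\<close>] .
    then show ?thesis using Mn[OF that] by (intro exI[of _ "d * M (1 / real n)"]) auto
  qed
  then obtain D where D: "\<And>n. n \<ge> 1 \<Longrightarrow> D n > 0" "\<And>n. n \<ge> 1 \<Longrightarrow> ennreal (D n / M (1 / real n)) \<le> S n"
    by metis
  define d where "d = Min (insert (1 / 4) (D ` {1..<N}))"
  have "d > 0" unfolding d_def using D(1) by (subst Min_gr_iff) auto
  moreover have "ennreal (d / M (1 / real n)) \<le> S n" if "n \<ge> 1" for n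
  proof (cases "n < N")
    case True
    then have "d \<le> D n" unfolding d_def using that by (intro Min_le) auto
    then have "ennreal (d / M (1 / real n)) \<le> ennreal (D n / M (1 / real n))"
      using Mn[OF that] by (intro ennreal_leI divide_right_mono) auto
    then show ?thesis using D(2)[OF that] by (rule order_trans)
  next
    case False
    have "d \<le> 1 / 4" unfolding d_def by (intro Min_le) auto
    then have "ennreal (d / M (1 / real n)) \<le> ennreal (1 / 4 / M (1 / real n))"
      using Mn[OF that] by (intro ennreal_leI divide_right_mono) auto
    then show ?thesis using large that False by (meson order_trans not_less)
  qed
  ultimately show ?thesis by (rule that)
qed

section \<open>Two-sided bounds for the moments\<close>

definition \<omega> :: "nat \<Rightarrow> real" where "\<omega> n = integral {0..1} (\<lambda>t. (1 - t) ^ n * W t)"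

lemma power_W_integrable: "(\<lambda>t. (1 - t) ^ n * W t) integrable_on {0..1}"
proof -
  have "W absolutely_integrable_on {0..1}"
    by (rule nonnegative_absolutely_integrable_1[OF W_integrable]) (use W_nonneg in auto)
  then have "(\<lambda>t. (1 - t) ^ n * W t) absolutely_integrable_on {0..1}"
  proof (intro absolutely_integrable_bounded_measurable_product_real)
    have *: "continuous_on {0..1} (\<lambda>t::real. (1 - t) ^ n)" by (intro continuous_intros)
    then show "(\<lambda>t::real. (1 - t) ^ n) \<in> borel_measurable (lebesgue_on {0..1})"
      by (rule continuous_imp_measurable_on_sets_lebesgue) simp
    show "bounded ((\<lambda>t::real. (1 - t) ^ n) ` {0..1})"
      by (rule compact_imp_bounded[OF compact_continuous_image[OF *]]) simp
  qed auto
  then show ?thesis by (rule set_lebesgue_integral_eq_integral(1))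
qed

text \<open>Bernoulli's inequality keeps (1 - s)^n above 1/2 on [0, 1/(2n)], and doubling from
  1/(2n) to 1/n costs at most 4; together this is the 8.\<close>

lemma \<omega>_lower:
  assumes n: "n \<ge> 1"
  shows "M (1 / real n) / 8 \<le> \<omega> n"
proof -
  define t where "t = 1 / (2 * real n)"
  have t: "0 < t" "t \<le> 1 / 2" "1 / real n = 2 * t" using n by (auto simp: t_def field_simps)
  have "M (1 / real n) \<le> 2 * c * M t" using M_doubling[of t] t by simp
  also have "\<dots> \<le> 4 * M t" using c M_nonneg[of t] t by (intro mult_right_mono) auto
  finally have 1: "M (1 / real n) / 8 \<le> M t / 2" by simp
  have "M t / 2 = integral {0..t} (\<lambda>s. 1 / 2 * W s)" by (simp add: M_def)
  also have "\<dots> \<le> integral {0..t} (\<lambda>s. (1 - s) ^ n * W s)"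
  proof (rule integral_le)
    show "(\<lambda>s. 1 / 2 * W s) integrable_on {0..t}"
      using t by (intro integrable_on_mult_right W_integrable_sub) auto
    show "(\<lambda>s. (1 - s) ^ n * W s) integrable_on {0..t}"
      by (rule integrable_subinterval_real[OF power_W_integrable]) (use t in auto)
    fix s assume s: "s \<in> {0..t}"
    have "1 + real n * (- s) \<le> (1 + (- s)) ^ n"
      using s t by (intro Bernoulli_inequality) auto
    moreover have "real n * s \<le> real n * t" using s by (intro mult_left_mono) auto
    moreover have "real n * t = 1 / 2" using n by (simp add: t_def)
    ultimately have "1 / 2 \<le> (1 - s) ^ n" by simp
    then show "1 / 2 * W s \<le> (1 - s) ^ n * W s"
      using s t W_nonneg[of s] by (intro mult_right_mono) auto
  qed
  also have "\<dots> \<le> \<omega> n" unfolding \<omega>_def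
  proof (rule integral_subset_le[OF _ _ power_W_integrable])
    show "(\<lambda>s. (1 - s) ^ n * W s) integrable_on {0..t}"
      by (rule integrable_subinterval_real[OF power_W_integrable]) (use t in auto)
  qed (use t W_nonneg in auto)
  finally show ?thesis using 1 by simp
qed

lemma \<omega>_pos: "n \<ge> 1 \<Longrightarrow> 0 < \<omega> n"
  using \<omega>_lower[of n] M_pos[of "1 / real n"] by auto

lemma exp_minus_le_cube: "0 < y \<Longrightarrow> exp (- y) \<le> 6 / y ^ 3" for y :: real
proof -
  assume y: "0 < y"
  have "(\<Sum>i\<in>{3}. y ^ i /\<^sub>R fact i) \<le> (\<Sum>i. y ^ i /\<^sub>R fact i)"
    using y summable_exp_generic[of y] by (intro sum_le_suminf) auto
  then have "y ^ 3 /\<^sub>R fact 3 \<le> exp y" by (simp only: exp_def sum.insert sum.empty) simp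
  then have "y ^ 3 / 6 \<le> exp y" by (simp add: fact_numeral)
  then show ?thesis using y by (simp add: exp_minus field_simps)
qed

text \<open>Put T = 1/n and y = s/T. Then W(s) is at most 4 M(s)/s, M(s) at most 4 y^2 M(T), and (1
  - s)^n at most e^(-y). The cubic bound on e^(-y) leaves 1/(y s) = T/s^2, whose integral over [T,1]
  is at most 1; a quadratic bound would leave 1/s and hence a logarithm. The constant is 96 = 4 * 4
  * 6.\<close>

lemma power_W_tail:
  assumes n: "n \<ge> 1" and s: "1 / real n \<le> s" "s \<le> 1"
  shows "(1 - s) ^ n * W s \<le> 96 * M (1 / real n) * (1 / real n) * (1 / s\<^sup>2)"
proof (cases "s = 1")
  \<comment> \<open>\<open>W_le_M\<close> does not reach s = 1, but there the power is 0 because n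
    is positive.\<close>
  case True
  then show ?thesis using n M_nonneg[of "1 / real n"] by (simp add: zero_power)
next
  case False
  define T where "T = 1 / real n"
  have T: "0 < T" "T \<le> s" using n s by (auto simp: T_def)
  define y where "y = s / T"
  have y1: "1 \<le> y" and y2: "y * T = s" using T by (simp_all add: y_def)
  have y3: "exp (- s) ^ n = exp (- y)"
    by (simp add: y_def T_def mult.commute flip: exp_of_nat_mult)
  have MT: "0 < M T" using M_pos[of T] T s by auto
  have "(1 - s) ^ n \<le> exp (- s) ^ n"
    using exp_ge_add_one_self[of "- s"] s by (intro power_mono) auto
  also have "\<dots> = exp (- y)" by (rule y3)
  also have "\<dots> \<le> 6 / y ^ 3" using y1 by (intro exp_minus_le_cube) auto
  finally have 1: "(1 - s) ^ n \<le> 6 / y ^ 3" .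
  have "s * W s \<le> 4 * M s" using W_le_M[of s] T s False by auto
  also have "M s \<le> 4 * y powr \<beta> * M T" unfolding y_def using M_growth[of T s] T s by auto
  also have "y powr \<beta> \<le> y powr 2" using y1 \<beta> by (intro powr_mono) auto
  also have "y powr 2 = y\<^sup>2" using y1 by simp
  finally have "s * W s \<le> 16 * y\<^sup>2 * M T" using MT by (simp add: mult_right_mono)
  then have 2: "W s \<le> 16 * y\<^sup>2 * M T / s" using T s by (simp add: field_simps)
  have "(1 - s) ^ n * W s \<le> (6 / y ^ 3) * (16 * y\<^sup>2 * M T / s)"
    using 1 2 W_nonneg[of s] T s y1 by (intro mult_mono) auto
  also have "\<dots> = 96 * M T * T * (1 / s\<^sup>2)"
  proof -
    have "(6 / y ^ 3) * (16 * y\<^sup>2 * M T / (y * T)) = 96 * M T * T * (1 / (y * T)\<^sup>2)"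
      using y1 T by (simp add: field_simps power2_eq_square power3_eq_cube)
    then show ?thesis unfolding y2 .
  qed
  finally show ?thesis by (simp add: T_def)
qed

text \<open>97 = 1 + 96: up to 1/n the power is bounded by 1, beyond it \<open>power_W_tail\<close>
  is integrated.\<close>

lemma \<omega>_upper:
  assumes n: "n \<ge> 1"
  shows "\<omega> n \<le> 97 * M (1 / real n)"
proof -
  define T where "T = 1 / real n"
  have T: "0 < T" "T \<le> 1" using n by (auto simp: T_def)
  have MT: "0 < M T" using M_pos[of T] T by auto
  let ?f = "\<lambda>t. (1 - t) ^ n * W t"
  have int: "?f integrable_on {a..b}" if "0 \<le> a" "b \<le> 1" for a b
    by (rule integrable_subinterval_real[OF power_W_integrable]) (use that in auto)
  have "\<omega> n = integral {0..T} ?f + integral {T..1} ?f" unfolding \<omega>_def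
    using T by (intro Henstock_Kurzweil_Integration.integral_combine[symmetric] power_W_integrable) auto
  also have "integral {0..T} ?f \<le> M T" unfolding M_def
  proof (rule integral_le[OF int W_integrable_sub])
    fix s assume "s \<in> {0..T}"
    then show "(1 - s) ^ n * W s \<le> W s"
      using T W_nonneg[of s] by (intro mult_left_le_one_le power_le_one) auto
  qed (use T in auto)
  also have "integral {T..1} ?f \<le> 96 * M T * T * (1 / T - 1)"
  proof -
    have "((\<lambda>s. - 1 / s) has_vector_derivative 1 / s\<^sup>2) (at s within {T..1})" if "s \<in> {T..1}" for s
    proof -
      have "((\<lambda>s. - 1 / s) has_real_derivative 1 / s\<^sup>2) (at s within {T..1})"
        using that T by (auto intro!: derivative_eq_intros simp: power2_eq_square)
      then show ?thesis by (simp add: has_real_derivative_iff_has_vector_derivative)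
    qed
    from fundamental_theorem_of_calculus[OF T(2) this]
    have "((\<lambda>s. 1 / s\<^sup>2) has_integral (- 1 / 1 - (- 1 / T))) {T..1}" by blast
    then have 1: "((\<lambda>s. 96 * M T * T * (1 / s\<^sup>2)) has_integral (96 * M T * T * (1 / T - 1))) {T..1}"
      by (intro has_integral_mult_right) simp
    show ?thesis
      by (rule has_integral_le[OF integrable_integral[OF int] 1]) (use power_W_tail[OF n] T in \<open>auto simp: T_def\<close>)
  qed
  also have "96 * M T * T * (1 / T - 1) \<le> 96 * M T"
    using T MT by (simp add: field_simps)
  finally show ?thesis by (simp add: T_def)
qed

lemma S_asymp:
  obtains c1 c2 where "c1 > 0" "c2 > 0" "\<And>n. n \<ge> 1 \<Longrightarrow> ennreal (c1 * (1 / \<omega> n)) \<le> S n"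
    "\<And>n. n \<ge> 1 \<Longrightarrow> S n \<le> ennreal (c2 * (1 / \<omega> n))"
proof -
  obtain d where d: "d > 0" "\<And>n. n \<ge> 1 \<Longrightarrow> ennreal (d / M (1 / real n)) \<le> S n"
    using S_lower by blast
  define C where "C = 4 * pi\<^sup>2 / (2 - \<beta>) + 1"
  have C: "C > 0" using \<beta> by (auto simp: C_def intro!: add_nonneg_pos)
  show thesis
  \<comment> \<open>By the two moment bounds, 1/M(1/n) lies between 1/(8 \<omega>(n)) and
    97/\<omega>(n).\<close>
  proof (rule that[of "d / 8" "97 * C"])
    fix n :: nat assume n: "n \<ge> 1"
    have Mn: "0 < M (1 / real n)" using n by (intro M_pos) auto
    have "d / 8 * (1 / \<omega> n) \<le> d / M (1 / real n)"
      using \<omega>_lower[OF n] \<omega>_pos[OF n] Mn d(1) by (simp add: field_simps)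
    then show "ennreal (d / 8 * (1 / \<omega> n)) \<le> S n"
      using d(2)[OF n] by (meson ennreal_leI order_trans)
    have "C / M (1 / real n) \<le> 97 * C * (1 / \<omega> n)"
      using \<omega>_upper[OF n] \<omega>_pos[OF n] Mn C by (simp add: field_simps)
    then show "S n \<le> ennreal (97 * C * (1 / \<omega> n))"
      using S_upper[OF n] unfolding C_def[symmetric] by (meson ennreal_leI order_trans)
  qed (use d C in auto)
qed

end

subsection \<open>Parseval's identity\<close>

text \<open>Half-open, so that each residue class modulo 2 pi has exactly one representative, and
  with Borel rather than Lebesgue measurable sets, so that compositions such as p(t + u) remain
  measurable.\<close>

abbreviation circ :: "real measure" where
  "circ \<equiv> restrict_space lborel {-pi..<pi}"

text \<open>Measurability is required on the whole line, since translates leave the interval;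
  integrability concerns one period only.\<close>

definition sq_int :: "(real \<Rightarrow> complex) \<Rightarrow> bool" where
  "sq_int g \<longleftrightarrow> g \<in> borel_measurable borel \<and> integrable circ (\<lambda>t. (norm (g t))\<^sup>2)"

definition fc :: "(real \<Rightarrow> complex) \<Rightarrow> int \<Rightarrow> complex" where
  "fc g n = (LINT t|circ. g t * cis (- of_int n * t)) / (2 * of_real pi)"

text \<open>For finite \<open>G\<close> this is the squared L^2 distance of \<open>g\<close> from
  the span of the exponentials with frequencies in \<open>G\<close>.\<close>

definition gap :: "int set \<Rightarrow> (real \<Rightarrow> complex) \<Rightarrow> real" where
  "gap G g = (LINT t|circ. (norm (g t))\<^sup>2) - 2 * pi * (\<Sum>n\<in>G. (norm (fc g n))\<^sup>2)"

lemma emeasure_circ_space: "emeasure circ (space circ) = ennreal (2 * pi)"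
proof -
  have "emeasure circ {-pi..<pi} = emeasure lborel {-pi..<pi}"
    by (rule emeasure_restrict_space) auto
  also have "\<dots> = ennreal (pi - (- pi))"
    by (rule emeasure_lborel_Ico) simp
  also have "pi - (- pi) = 2 * pi" by simp
  finally have 1: "emeasure circ {-pi..<pi} = ennreal (2 * pi)" .
  have 2: "space circ = {-pi..<pi}" by (simp add: space_restrict_space)
  show ?thesis unfolding 2 by (rule 1)
qed

lemma finite_measure_circ: "finite_measure circ"
  by (rule finite_measureI) (subst emeasure_circ_space, simp)

lemma measure_circ_space: "measure circ (space circ) = 2 * pi"
  unfolding measure_def emeasure_circ_space by simp

lemma measurable_circI [intro]: "g \<in> borel_measurable borel \<Longrightarrow> g \<in> borel_measurable circ"
  by (rule measurable_restrict_space1) simp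

lemma measurable_cis [measurable]: "cis \<in> borel_measurable borel"
  by (intro borel_measurable_continuous_onI continuous_intros)

lemma integral_cis_circ: "(LINT t|circ. cis (of_int n * t)) = (if n = 0 then 2 * of_real pi else 0)"
proof (cases "n = 0")
  case True
  then show ?thesis
    using measure_circ_space by (simp add: lebesgue_integral_const scaleR_conv_of_real)
next
  case False
  define F where "F t = cis (of_int n * t) / (\<i> * of_int n)" for t :: real
  have der: "(F has_vector_derivative cis (of_int n * t)) (at t within A)" for t A
  proof -
    have "((\<lambda>z. exp (\<i> * of_int n * z) / (\<i> * of_int n)) has_field_derivative exp (\<i> * of_int n * of_real t)) (at (of_real t))"
      using False by (auto intro!: derivative_eq_intros)
    from has_vector_derivative_real_field[OF this] show ?thesis
      by (simp add: F_def[abs_def] cis_conv_exp o_def mult.assoc)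
  qed
  have "(LINT t|circ. cis (of_int n * t)) = (LINT t|lborel. indicator {-pi..<pi} t *\<^sub>R cis (of_int n * t))"
    by (subst integral_restrict_space) auto
  also have "\<dots> = (LINT t|lborel. indicator {-pi..pi} t *\<^sub>R cis (of_int n * t))"
  proof (rule integral_cong_AE)
    show "AE t in lborel. indicator {-pi..<pi} t *\<^sub>R cis (of_int n * t) = indicator {-pi..pi} t *\<^sub>R cis (of_int n * t)"
      using AE_lborel_singleton[of pi] by eventually_elim (auto simp: indicator_def)
  qed measurable
  also have "\<dots> = F pi - F (- pi)"
    by (rule integral_FTC_Icc) (auto intro!: der continuous_intros)
  also have "\<dots> = 0"
  proof -
    have "cis (of_int n * pi) = cis (of_int n * (-pi))"
      using cis_multiple_2pi[of "of_int n"] cis_mult[of "of_int n * (-pi)" "2 * pi * of_int n"]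
      by (simp add: algebra_simps)
    then show ?thesis by (simp add: F_def)
  qed
  finally show ?thesis using False by simp
qed

lemma sq_int_integrable: "sq_int g \<Longrightarrow> integrable circ g"
proof -
  assume g: "sq_int g"
  interpret finite_measure circ by (rule finite_measure_circ)
  have "integrable circ (\<lambda>t. 1 + (norm (g t))\<^sup>2)"
    using g by (auto simp: sq_int_def)
  then show ?thesis
  proof (rule Bochner_Integration.integrable_bound)
    show "g \<in> borel_measurable circ" using g by (auto simp: sq_int_def)
    have "x \<le> 1 + x\<^sup>2" for x :: real
      using zero_le_power2[of "x - 1/2"] by (simp add: power2_diff field_simps power2_eq_square)
    then show "AE x in circ. norm (g x) \<le> norm (1 + (norm (g x))\<^sup>2)" by auto
  qed
qed

lemma sq_int_mult_bounded:
  assumes "sq_int g" "b \<in> borel_measurable borel" "\<And>t. norm (b t) \<le> B"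
  shows "sq_int (\<lambda>t. g t * b t)"
  unfolding sq_int_def
proof
  show "(\<lambda>t. g t * b t) \<in> borel_measurable borel" using assms by (auto simp: sq_int_def)
  have "integrable circ (\<lambda>t. B\<^sup>2 * (norm (g t))\<^sup>2)"
    using assms by (auto simp: sq_int_def)
  then show "integrable circ (\<lambda>t. (norm (g t * b t))\<^sup>2)"
  proof (rule Bochner_Integration.integrable_bound)
    show "(\<lambda>t. (norm (g t * b t))\<^sup>2) \<in> borel_measurable circ"
      using assms by (auto simp: sq_int_def intro!: measurable_circI)
    have "(norm (g t))\<^sup>2 * (norm (b t))\<^sup>2 \<le> B\<^sup>2 * (norm (g t))\<^sup>2" for t
      using power_mono[OF assms(3), of t 2] mult_left_mono[of "(norm (b t))\<^sup>2" "B\<^sup>2" "(norm (g t))\<^sup>2"] by (simp add: mult.commute)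
    then show "AE x in circ. norm ((norm (g x * b x))\<^sup>2) \<le> norm (B\<^sup>2 * (norm (g x))\<^sup>2)"
      by (simp add: norm_mult power_mult_distrib)
  qed
qed

lemma norm_diff_sq_le: "(norm (a - b))\<^sup>2 \<le> 2 * (norm a)\<^sup>2 + 2 * (norm (b::'a::real_normed_vector))\<^sup>2"
proof -
  have "(norm (a - b))\<^sup>2 \<le> (norm a + norm b)\<^sup>2"
    by (intro power_mono norm_triangle_ineq4) auto
  also have "\<dots> \<le> 2 * (norm a)\<^sup>2 + 2 * (norm b)\<^sup>2"
    using zero_le_power2[of "norm a - norm b"] by (simp add: power2_eq_square algebra_simps)
  finally show ?thesis .
qed

lemma sq_int_diff:
  assumes "sq_int f" "sq_int g"
  shows "sq_int (\<lambda>t. f t - g t)"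
  unfolding sq_int_def
proof
  show "(\<lambda>t. f t - g t) \<in> borel_measurable borel" using assms by (auto simp: sq_int_def)
  have "integrable circ (\<lambda>t. 2 * (norm (f t))\<^sup>2 + 2 * (norm (g t))\<^sup>2)"
    using assms by (auto simp: sq_int_def)
  then show "integrable circ (\<lambda>t. (norm (f t - g t))\<^sup>2)"
  proof (rule Bochner_Integration.integrable_bound)
    show "(\<lambda>t. (norm (f t - g t))\<^sup>2) \<in> borel_measurable circ"
      using assms by (auto simp: sq_int_def intro!: measurable_circI)
  qed (use norm_diff_sq_le in auto)
qed

lemma sq_int_bounded:
  assumes "g \<in> borel_measurable borel" "\<And>t. norm (g t) \<le> B"
  shows "sq_int g"
proof -
  interpret finite_measure circ by (rule finite_measure_circ)
  have "sq_int (\<lambda>_. 1)" by (auto simp: sq_int_def)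
  from sq_int_mult_bounded[OF this assms] show ?thesis by simp
qed

lemma sq_int_cis: "sq_int (\<lambda>t. a * cis (of_int n * t))"
  by (rule sq_int_bounded[of _ "norm a"]) (auto simp: norm_mult)

lemma fc_diff:
  assumes "sq_int f" "sq_int g"
  shows "fc (\<lambda>t. f t - g t) n = fc f n - fc g n"
proof -
  have "integrable circ (\<lambda>t. f t * cis (- of_int n * t))" "integrable circ (\<lambda>t. g t * cis (- of_int n * t))"
    by (rule sq_int_integrable[OF sq_int_mult_bounded[OF assms(1), of _ 1]] 
          sq_int_integrable[OF sq_int_mult_bounded[OF assms(2), of _ 1]]; simp)+
  then show ?thesis
    by (simp add: fc_def left_diff_distrib diff_divide_distrib)
qed

lemma fc_cis: "fc (\<lambda>t. a * cis (of_int m * t)) n = (if n = m then a else 0)"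
proof -
  have "(LINT t|circ. a * cis (of_int m * t) * cis (- of_int n * t)) = (LINT t|circ. a * cis (of_int (m - n) * t))"
    by (intro Bochner_Integration.integral_cong) (auto simp: cis_mult mult.assoc algebra_simps)
  also have "\<dots> = a * (if m - n = 0 then 2 * of_real pi else 0)"
    by (simp only: integral_mult_right_zero integral_cis_circ)
  finally show ?thesis by (simp add: fc_def)
qed

lemma norm_diff_sq: "(norm (x - y))\<^sup>2 = (norm x)\<^sup>2 - 2 * Re (x * cnj y) + (norm (y::complex))\<^sup>2"
  by (simp only: cmod_power2 minus_complex.sel times_complex.sel complex_cnj) (simp add: power2_eq_square algebra_simps)

text \<open>
  Subtracting a trigonometric polynomial with frequencies in \<open>G\<close> does not change the gap.  This
  yields both Bessel's inequality (subtract the partial Fourier sum) and, by density of the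
  trigonometric polynomials, Parseval's identity.
\<close>
lemma gap_diff_cis:
  assumes g: "sq_int g" and "finite G" "m \<in> G"
  shows "gap G (\<lambda>t. g t - a * cis (of_int m * t)) = gap G g"
proof -
  interpret finite_measure circ by (rule finite_measure_circ)
  have int: "integrable circ (\<lambda>t. g t * cis (- of_int m * t))"
    by (rule sq_int_integrable[OF sq_int_mult_bounded[OF g, of _ 1]]) simp_all
  have "(LINT t|circ. (norm (g t - a * cis (of_int m * t)))\<^sup>2)
      = (LINT t|circ. (norm (g t))\<^sup>2 - 2 * Re (cnj a * (g t * cis (- of_int m * t))) + (norm a)\<^sup>2)"
  proof (intro Bochner_Integration.integral_cong refl)
    fix t
    have "g t * cnj (a * cis (of_int m * t)) = cnj a * (g t * cis (- of_int m * t))"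
      by (simp add: cis_cnj)
    then show "(norm (g t - a * cis (of_int m * t)))\<^sup>2
      = (norm (g t))\<^sup>2 - 2 * Re (cnj a * (g t * cis (- of_int m * t))) + (norm a)\<^sup>2"
      by (simp only: norm_diff_sq norm_mult norm_cis mult_1_right)
  qed
  also have "\<dots> = (LINT t|circ. (norm (g t))\<^sup>2) - 2 * (LINT t|circ. Re (cnj a * (g t * cis (- of_int m * t)))) + 2 * pi * (norm a)\<^sup>2"
  proof -
    define J where "J t = Re (cnj a * (g t * cis (- of_int m * t)))" for t
    have "integrable circ (\<lambda>t. cnj a * (g t * cis (- of_int m * t)))"
      using int by (rule integrable_mult_right)
    then have "integrable circ J"
      unfolding J_def by (rule integrable_Re)
    then show ?thesis
      unfolding J_def[symmetric] using g measure_circ_space by (simp add: sq_int_def lebesgue_integral_const)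
  qed
  also have "(LINT t|circ. Re (cnj a * (g t * cis (- of_int m * t)))) = Re (LINT t|circ. cnj a * (g t * cis (- of_int m * t)))"
    using int by (intro integral_Re) auto
  also have "(LINT t|circ. cnj a * (g t * cis (- of_int m * t))) = cnj a * (2 * of_real pi * fc g m)"
    by (simp add: fc_def)
  also have "Re (cnj a * (2 * of_real pi * fc g m)) = 2 * pi * Re (fc g m * cnj a)"
    by (simp add: algebra_simps)
  finally have 1: "(LINT t|circ. (norm (g t - a * cis (of_int m * t)))\<^sup>2) =
     (LINT t|circ. (norm (g t))\<^sup>2) - 2 * (2 * pi * Re (fc g m * cnj a)) + 2 * pi * (norm a)\<^sup>2" .
  have "(\<Sum>n\<in>G. (norm (fc (\<lambda>t. g t - a * cis (of_int m * t)) n))\<^sup>2)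
     = (\<Sum>n\<in>G. (norm (fc g n - (if n = m then a else 0)))\<^sup>2)"
    by (simp only: fc_diff[OF g sq_int_cis] fc_cis)
  also have "\<dots> = (\<Sum>n\<in>G. (norm (fc g n))\<^sup>2 + (if n = m then - 2 * Re (fc g m * cnj a) + (norm a)\<^sup>2 else 0))"
    by (intro sum.cong) (auto simp: norm_diff_sq)
  also have "\<dots> = (\<Sum>n\<in>G. (norm (fc g n))\<^sup>2) + (- 2 * Re (fc g m * cnj a) + (norm a)\<^sup>2)"
    using assms by (simp add: sum.distrib)
  finally have 2: "(\<Sum>n\<in>G. (norm (fc (\<lambda>t. g t - a * cis (of_int m * t)) n))\<^sup>2)
     = (\<Sum>n\<in>G. (norm (fc g n))\<^sup>2) + (- 2 * Re (fc g m * cnj a) + (norm a)\<^sup>2)" .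
  show ?thesis unfolding gap_def 1 2 by (simp add: algebra_simps)
qed

lemma gap_nonneg:
  assumes "finite G" "sq_int g"
  shows "0 \<le> gap G g"
  using assms
proof (induction G arbitrary: g rule: finite_induct)
  case empty
  then show ?case by (simp add: gap_def)
next
  case (insert m G)
  let ?g = "\<lambda>t. g t - fc g m * cis (of_int m * t)"
  have s: "sq_int ?g" by (intro sq_int_diff sq_int_cis insert)
  have z: "fc ?g m = 0"
    by (simp only: fc_diff[OF \<open>sq_int g\<close> sq_int_cis] fc_cis) simp
  have "gap (insert m G) g = gap (insert m G) ?g"
    using insert by (intro gap_diff_cis[symmetric]) auto
  also have "\<dots> = gap G ?g"
    using insert z by (simp add: gap_def)
  finally show ?case using insert.IH[OF s] by simp
qed

section \<open>Density of the trigonometric polynomials\<close>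

inductive trig_poly :: "(real \<Rightarrow> complex) \<Rightarrow> bool" where
  zero: "trig_poly (\<lambda>_. 0)"
| add_term: "trig_poly p \<Longrightarrow> trig_poly (\<lambda>t. p t + a * cis (of_int n * t))"

lemma trig_poly_gap:
  assumes "trig_poly p"
  shows "sq_int p \<and> (\<exists>F. finite F \<and> (\<forall>g. sq_int g \<longrightarrow> gap F (\<lambda>t. g t - p t) = gap F g))"
proof -
  \<comment> \<open>Strengthened to all finite supersets of \<open>F\<close>, because the induction
    step adds a frequency to \<open>F\<close>.\<close>
  have "sq_int p \<and> (\<exists>F. finite F \<and> (\<forall>G g. F \<subseteq> G \<longrightarrow> finite G \<longrightarrow> sq_int g \<longrightarrow> gap G (\<lambda>t. g t - p t) = gap G g))"
    using assms
  proof induction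
    case zero
    have "sq_int (\<lambda>_. 0)" by (simp add: sq_int_def)
    then show ?case by auto
  next
    case (add_term p a n)
    then obtain F where F: "finite F" 
      "\<And>G g. F \<subseteq> G \<Longrightarrow> finite G \<Longrightarrow> sq_int g \<Longrightarrow> gap G (\<lambda>t. g t - p t) = gap G g" and p: "sq_int p"
      by blast
    have "sq_int (\<lambda>t. p t - (- a) * cis (of_int n * t))"
      by (intro sq_int_diff p sq_int_cis)
    then have 1: "sq_int (\<lambda>t. p t + a * cis (of_int n * t))" by simp
    have "gap G (\<lambda>t. g t - (p t + a * cis (of_int n * t))) = gap G g"
      if "insert n F \<subseteq> G" "finite G" "sq_int g" for G g
    proof -
      have "gap G (\<lambda>t. (g t - p t) - a * cis (of_int n * t)) = gap G (\<lambda>t. g t - p t)"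
        using that by (intro gap_diff_cis sq_int_diff p) auto
      also have "\<dots> = gap G g" using F(2)[of G g] that by auto
      finally show ?thesis by (simp add: algebra_simps)
    qed
    with 1 F(1) show ?case
      by (intro conjI exI[of _ "insert n F"]) auto
  qed
  then show ?thesis by blast
qed

lemma trig_poly_add: "trig_poly p \<Longrightarrow> trig_poly q \<Longrightarrow> trig_poly (\<lambda>t. q t + p t)"
proof (induction rule: trig_poly.induct)
  case (add_term p a n)
  then show ?case using trig_poly.add_term[of "\<lambda>t. q t + p t" a n] by (simp add: add.assoc)
qed simp

lemma trig_poly_term: "trig_poly (\<lambda>t. a * cis (of_int n * t))"
  using add_term[OF zero, of a n] by simp

lemma trig_poly_const: "trig_poly (\<lambda>t. a)"
  using trig_poly_term[of a 0] by simp

lemma trig_poly_mult_term: "trig_poly p \<Longrightarrow> trig_poly (\<lambda>t. p t * (a * cis (of_int n * t)))"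
proof (induction rule: trig_poly.induct)
  case zero
  then show ?case by (simp add: trig_poly.zero)
next
  case (add_term p b m)
  from trig_poly.add_term[OF add_term.IH, of "b * a" "m + n"]
  show ?case by (rule back_subst[of trig_poly]) (auto simp: fun_eq_iff algebra_simps simp flip: cis_mult)
qed

lemma trig_poly_mult: "trig_poly p \<Longrightarrow> trig_poly q \<Longrightarrow> trig_poly (\<lambda>t. q t * p t)"
proof (induction rule: trig_poly.induct)
  case zero
  then show ?case by (simp add: trig_poly.zero)
next
  case (add_term p a n)
  from trig_poly_add[OF trig_poly_mult_term[OF \<open>trig_poly q\<close>, of a n] add_term.IH[OF \<open>trig_poly q\<close>]]
  show ?case by (simp add: algebra_simps)
qed

text \<open>The polynomials of the Stone-Weierstrass theorem are real polynomials in the coordinates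
  of the plane. On the circle a real-linear functional is f(1) cos t + f(i) sin t, so Euler's
  formulas bring in the frequencies 1 and -1, and closure under sums and products does the
  rest.\<close>

lemma trig_poly_real_polynomial:
  assumes "real_polynomial_function (p :: complex \<Rightarrow> real)"
  shows "trig_poly (\<lambda>t. of_real (p (cis t)))"
  using assms
proof induction
  case (linear f)
  interpret f: bounded_linear f by (rule linear)
  have "of_real (f (cis t)) = (of_real (f 1) - \<i> * of_real (f \<i>)) / 2 * cis (of_int 1 * t)
      + (of_real (f 1) + \<i> * of_real (f \<i>)) / 2 * cis (of_int (-1) * t)" for t
  proof -
    have "cis t = cos t *\<^sub>R 1 + sin t *\<^sub>R \<i>" by (simp add: complex_eq_iff)
    then have "f (cis t) = cos t * f 1 + sin t * f \<i>" by (metis f.add f.scaleR real_scaleR_def)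
    then show ?thesis by (simp add: complex_eq_iff field_simps)
  qed
  then show ?case
    using trig_poly_add[OF trig_poly_term trig_poly_term] by presburger
next
  case (const c)
  then show ?case by (rule trig_poly_const)
next
  case (add f g)
  then show ?case using trig_poly_add by force
next
  case (mult f g)
  then show ?case using trig_poly_mult by force
qed

lemma trig_poly_polynomial:
  assumes "polynomial_function (p :: complex \<Rightarrow> complex)"
  shows "trig_poly (\<lambda>t. p (cis t))"
proof -
  have "trig_poly (\<lambda>t. of_real ((Re \<circ> p) (cis t)))" "trig_poly (\<lambda>t. of_real ((Im \<circ> p) (cis t)))"
    using assms bounded_linear_Re bounded_linear_Im unfolding polynomial_function_def 
    by (blast intro: trig_poly_real_polynomial)+
  from trig_poly_add[OF trig_poly_mult[OF this(2) trig_poly_const[of \<i>]] this(1)]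
  show ?thesis by (rule back_subst[of trig_poly]) (simp add: fun_eq_iff complex_eq_iff o_def)
qed

text \<open>Equal end values let \<open>h\<close> descend to a continuous function on the circle, a
  compact set to which the Stone-Weierstrass theorem applies.\<close>

lemma trig_poly_dense_continuous:
  fixes h :: "real \<Rightarrow> complex"
  assumes h: "continuous_on {-pi..pi} h" "h (-pi) = h pi" and "e > 0"
  obtains p where "trig_poly p" "\<And>t. t \<in> {-pi..pi} \<Longrightarrow> norm (h t - p t) < e"
proof -
  let ?S = "{-pi..pi}" and ?T = "cis ` {-pi..pi}"
  define H where "H z = h (Arg z)" for z
  have hH: "H (cis t) = h t" if "t \<in> ?S" for t
  proof (cases "t = -pi")
    \<comment> \<open>\<open>Arg\<close> takes values in (-pi, pi], so -pi is the one point of the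
      interval where the equality of the end values is needed.\<close>
    case True
    then show ?thesis using h(2) Arg_cis[of pi] by (simp add: H_def cis.ctr)
  next
    case False
    then show ?thesis using that by (simp add: H_def Arg_cis)
  qed
  have cc: "continuous_on ?S cis" by (intro continuous_intros)
  \<comment> \<open>\<open>cis\<close> is a quotient map from the compact interval onto the circle.\<close>
  have "continuous_on ?T H"
    unfolding continuous_on_open_gen
  proof (rule continuous_on_open_invariant[THEN iffD2], clarify)
    fix B :: "complex set" assume "open B"
    have "openin (top_of_set ?S) (?S \<inter> h -` B)"
      using h(1) \<open>open B\<close> continuous_openin_preimage_gen by blast
    also have "?S \<inter> h -` B = ?S \<inter> cis -` (?T \<inter> H -` B)" by (auto simp flip: hH)
    finally have "openin (top_of_set ?T) (?T \<inter> H -` B)"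
      using Abstract_Topology_2.continuous_imp_quotient_map[OF cc refl, of "?T \<inter> H -` B"] by auto
    then show "\<exists>A. open A \<and> A \<inter> ?T = H -` B \<inter> ?T"
      unfolding openin_open by (metis Int_commute)
  qed
  moreover have "compact ?T" using cc by (rule compact_continuous_image) auto
  ultimately obtain g where g: "polynomial_function g" "\<forall>z\<in>?T. norm (H z - g z) < e"
    using Stone_Weierstrass_polynomial_function \<open>e > 0\<close> by metis
  show thesis
    using that[OF trig_poly_polynomial[OF g(1)]] g(2) hH by force
qed

text \<open>Measurability yields continuous \<open>g n\<close> that converge almost everywhere but
  without a common bound. The nearest-point map onto the ball of radius \<open>B\<close> is
  continuous and fixes the values of \<open>f\<close>, so it restores the bound and keeps the limit;
  dominated convergence follows.\<close>

lemma bounded_approx_continuous: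
  fixes f :: "real \<Rightarrow> complex"
  assumes f: "f \<in> borel_measurable borel" "\<And>t. norm (f t) \<le> B" and "e > 0"
  obtains h where "continuous_on UNIV h" "h (-pi) = h pi" "\<And>t. norm (h t) \<le> B"
    "(LINT t|circ. (norm (f t - h t))\<^sup>2) < e"
proof -
  interpret finite_measure circ by (rule finite_measure_circ)
  have B: "B \<ge> 0" using f(2)[of 0] norm_ge_zero order_trans by blast
  have "f measurable_on UNIV"
    using f(1) by (intro lebesgue_measurable_imp_measurable_on) (auto simp: measurable_completion)
  then obtain N g where N: "negligible N" and g: "\<And>n. continuous_on UNIV (g n)"
    "\<And>x. x \<notin> N \<Longrightarrow> (\<lambda>n. g n x) \<longlonglongrightarrow> f x"
    unfolding measurable_on_def by auto
  \<comment> \<open>The cutoff \<open>k n\<close> vanishes at \<open>- pi\<close> and \<open>pi\<close>, which makes the approximants periodic.\<close>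
  define k where "k n t = min 1 (real n * \<bar>t\<^sup>2 - pi\<^sup>2\<bar>)" for n :: nat and t :: real
  define h where "h n t = k n t *\<^sub>R closest_point (cball 0 B) (g n t)" for n t
  have cl: "continuous_on UNIV (closest_point (cball (0::complex) B))"
    using B by (intro continuous_on_closest_point) auto
  have hc: "continuous_on UNIV (h n)" for n
    unfolding h_def k_def
    by (intro continuous_intros continuous_on_compose2[OF cl g(1)]) auto
  have clB: "norm (closest_point (cball (0::complex) B) z) \<le> B" for z
    using closest_point_in_set[of "cball (0::complex) B" z] B by auto
  have k01: "0 \<le> k n t" "k n t \<le> 1" for n t by (auto simp: k_def)
  have hB: "norm (h n t) \<le> B" for n t
    using mult_mono[OF k01(2) clB] k01 B by (simp add: h_def)
  have lim: "(\<lambda>n. h n t) \<longlonglongrightarrow> f t" if t: "t \<in> {-pi<..<pi}" "t \<notin> N" for t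
  proof -
    have "\<bar>t\<bar> < \<bar>pi\<bar>" using t by auto
    then have "t\<^sup>2 < pi\<^sup>2" by (metis abs_ge_zero power2_abs power_strict_mono zero_less_numeral)
    then have p: "\<bar>t\<^sup>2 - pi\<^sup>2\<bar> > 0" by simp
    have "eventually (\<lambda>n. 1 / \<bar>t\<^sup>2 - pi\<^sup>2\<bar> \<le> real n) sequentially"
      using filterlim_real_sequentially by (auto simp: filterlim_at_top)
    then have "eventually (\<lambda>n. k n t = 1) sequentially"
      by eventually_elim (use p in \<open>auto simp: k_def field_simps\<close>)
    then have 1: "(\<lambda>n. k n t) \<longlonglongrightarrow> 1" by (rule tendsto_eventually)
    have "isCont (closest_point (cball 0 B)) (f t)"
      using cl by (simp add: continuous_on_eq_continuous_at)
    then have "(\<lambda>n. closest_point (cball 0 B) (g n t)) \<longlonglongrightarrow> closest_point (cball 0 B) (f t)"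
      using g(2)[OF t(2)] by (rule isCont_tendsto_compose)
    moreover have "closest_point (cball 0 B) (f t) = f t"
      using f(2)[of t] by (intro closest_point_self) auto
    ultimately show ?thesis
      using tendsto_scaleR[OF 1] by (fastforce simp: h_def)
  qed
  have hm [measurable]: "h n \<in> borel_measurable borel" for n
    by (intro borel_measurable_continuous_onI hc)
  note f(1)[measurable]
  have "(\<lambda>n. LINT t|circ. (norm (f t - h n t))\<^sup>2) \<longlonglongrightarrow> (LINT t|circ. 0)"
  proof (rule integral_dominated_convergence[where w = "\<lambda>_. (2 * B)\<^sup>2"])
    show "(\<lambda>t. (norm (f t - h n t))\<^sup>2) \<in> borel_measurable circ" for n
      by (rule measurable_circI) measurable
    have "norm (f t - h n t) \<le> 2 * B" for n t
      using norm_triangle_ineq4[of "f t" "h n t"] hB[of n t] f(2)[of t] by simp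
    then have "norm ((norm (f t - h n t))\<^sup>2) \<le> (2 * B)\<^sup>2" for n t
      using power_mono[OF _ norm_ge_zero, of "f t - h n t" "2 * B" 2] by simp
    then show "AE t in circ. norm ((norm (f t - h n t))\<^sup>2) \<le> (2 * B)\<^sup>2" for n
      by (intro AE_I2)
    have "AE t in lebesgue. t \<notin> N"
      using N by (simp add: AE_not_in negligible_iff_null_sets)
    then have "AE t in lborel. t \<notin> N"
      by (simp add: AE_completion_iff)
    then have "AE t in lborel. t \<in> {-pi..<pi} \<longrightarrow> (\<lambda>n. (norm (f t - h n t))\<^sup>2) \<longlonglongrightarrow> 0"
      using AE_lborel_singleton[of "-pi"]
    proof eventually_elim
      case (elim t)
      show ?case
      proof
        assume "t \<in> {-pi..<pi}"
        then have "(\<lambda>n. h n t) \<longlonglongrightarrow> f t" using elim by (intro lim) auto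
        then have "(\<lambda>n. (norm (f t - h n t))\<^sup>2) \<longlonglongrightarrow> (norm (f t - f t))\<^sup>2"
          by (intro tendsto_intros)
        then show "(\<lambda>n. (norm (f t - h n t))\<^sup>2) \<longlonglongrightarrow> 0" by simp
      qed
    qed
    then show "AE t in circ. (\<lambda>n. (norm (f t - h n t))\<^sup>2) \<longlonglongrightarrow> 0"
      by (subst AE_restrict_space_iff) auto
  qed auto
  then have "eventually (\<lambda>n. (LINT t|circ. (norm (f t - h n t))\<^sup>2) < e) sequentially"
    using \<open>e > 0\<close> by (auto dest: order_tendstoD)
  then obtain n where "(LINT t|circ. (norm (f t - h n t))\<^sup>2) < e"
    by (auto simp: eventually_sequentially)
  then show thesis
    using that[OF hc _ hB] by (force simp: h_def k_def)
qed

lemma sq_int_approx_bounded: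
  fixes f :: "real \<Rightarrow> complex"
  assumes f: "sq_int f" and "e > 0"
  obtains g B where "g \<in> borel_measurable borel" "\<And>t. norm (g t) \<le> B"
    "(LINT t|circ. (norm (f t - g t))\<^sup>2) < e"
proof -
  define g where "g n t = (if norm (f t) \<le> real n then f t else 0)" for n t
  have [measurable]: "f \<in> borel_measurable borel" using f by (auto simp: sq_int_def)
  have gm [measurable]: "g n \<in> borel_measurable borel" for n unfolding g_def by measurable
  have "(\<lambda>n. LINT t|circ. (norm (f t - g n t))\<^sup>2) \<longlonglongrightarrow> (LINT t|circ. 0)"
  proof (rule integral_dominated_convergence[where w = "\<lambda>t. (norm (f t))\<^sup>2"])
    show "(\<lambda>t. (norm (f t - g n t))\<^sup>2) \<in> borel_measurable circ" for n
      by (rule measurable_circI) measurable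
    show "AE t in circ. (\<lambda>n. (norm (f t - g n t))\<^sup>2) \<longlonglongrightarrow> 0"
    proof (rule AE_I2)
      fix t
      have "eventually (\<lambda>n. norm (f t) \<le> real n) sequentially"
        using filterlim_real_sequentially by (auto simp: filterlim_at_top)
      then have "eventually (\<lambda>n. (norm (f t - g n t))\<^sup>2 = 0) sequentially"
        by eventually_elim (simp add: g_def)
      then show "(\<lambda>n. (norm (f t - g n t))\<^sup>2) \<longlonglongrightarrow> 0" by (rule tendsto_eventually)
    qed
  qed (use f in \<open>auto simp: g_def sq_int_def\<close>)
  then have "eventually (\<lambda>n. (LINT t|circ. (norm (f t - g n t))\<^sup>2) < e) sequentially"
    using \<open>e > 0\<close> by (auto dest: order_tendstoD)
  then obtain n where "(LINT t|circ. (norm (f t - g n t))\<^sup>2) < e"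
    by (auto simp: eventually_sequentially)
  then show thesis
    using that[OF gm, of n "real n"] by (auto simp: g_def)
qed

lemma norm_sq_dist_triangle:
  assumes "sq_int f" "sq_int g" "sq_int h"
  shows "(LINT t|circ. (norm (f t - h t))\<^sup>2) \<le> 2 * (LINT t|circ. (norm (f t - g t))\<^sup>2) + 2 * (LINT t|circ. (norm (g t - h t))\<^sup>2)"
proof -
  have 1: "integrable circ (\<lambda>t. (norm (f t - h t))\<^sup>2)" "integrable circ (\<lambda>t. (norm (f t - g t))\<^sup>2)"
    "integrable circ (\<lambda>t. (norm (g t - h t))\<^sup>2)"
    using sq_int_diff assms by (auto simp: sq_int_def)
  have "(LINT t|circ. (norm (f t - h t))\<^sup>2) \<le> (LINT t|circ. 2 * (norm (f t - g t))\<^sup>2 + 2 * (norm (g t - h t))\<^sup>2)"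
    using 1 norm_diff_sq_le[of "f t - g t" "h t - g t" for t]
    by (intro integral_mono) (auto simp: norm_minus_commute)
  also have "\<dots> = 2 * (LINT t|circ. (norm (f t - g t))\<^sup>2) + 2 * (LINT t|circ. (norm (g t - h t))\<^sup>2)"
    using 1 by simp
  finally show ?thesis .
qed

lemma trig_poly_dense:
  assumes f: "sq_int f" and "e > 0"
  obtains p where "trig_poly p" "(LINT t|circ. (norm (f t - p t))\<^sup>2) < e"
proof -
  interpret finite_measure circ by (rule finite_measure_circ)
  \<comment> \<open>Two uses of \<open>norm_sq_dist_triangle\<close> bound the total error by 2d +
    2(2d + 2d) = 10d, which is below 16d.\<close>
  define d where "d = e / 16"
  have d: "d > 0" using \<open>e > 0\<close> by (simp add: d_def)
  obtain g B where g: "g \<in> borel_measurable borel" "\<And>t. norm (g t) \<le> B"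
    "(LINT t|circ. (norm (f t - g t))\<^sup>2) < d"
    using sq_int_approx_bounded[OF f d] by metis
  obtain h where h: "continuous_on UNIV h" "h (-pi) = h pi" "\<And>t. norm (h t) \<le> B"
    "(LINT t|circ. (norm (g t - h t))\<^sup>2) < d"
    using bounded_approx_continuous[OF g(1,2) d] by metis
  \<comment> \<open>A uniform error r contributes at most 2 pi r^2 = d to the squared norm.\<close>
  define r where "r = sqrt (d / (2 * pi))"
  have r: "r > 0" using d by (simp add: r_def)
  obtain p where p: "trig_poly p" "\<And>t. t \<in> {-pi..pi} \<Longrightarrow> norm (h t - p t) < r"
    using trig_poly_dense_continuous[OF continuous_on_subset[OF h(1)] h(2) r] by (metis subset_UNIV)
  have sq: "sq_int g" "sq_int h" "sq_int p"
    using sq_int_bounded[OF g(1,2)] sq_int_bounded[OF borel_measurable_continuous_onI[OF h(1)] h(3)] trig_poly_gap[OF p(1)]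
    by auto
  have "(LINT t|circ. (norm (h t - p t))\<^sup>2) \<le> (LINT t|circ. r\<^sup>2)"
  proof (rule integral_mono_AE)
    show "integrable circ (\<lambda>t. (norm (h t - p t))\<^sup>2)"
      using sq_int_diff[OF sq(2,3)] by (simp add: sq_int_def)
    show "AE t in circ. (norm (h t - p t))\<^sup>2 \<le> r\<^sup>2"
    proof (rule AE_I2)
      fix t assume "t \<in> space circ"
      then have "norm (h t - p t) \<le> r"
        using p(2)[of t] by (auto simp: space_restrict_space)
      then show "(norm (h t - p t))\<^sup>2 \<le> r\<^sup>2" by (rule power_mono) simp
    qed
  qed simp
  also have "\<dots> = d"
    using d measure_circ_space by (simp add: lebesgue_integral_const r_def)
  finally have "(LINT t|circ. (norm (f t - p t))\<^sup>2) < e"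
    using norm_sq_dist_triangle[OF f sq(1,3)] norm_sq_dist_triangle[OF sq] g(3) h(4) d
    unfolding d_def by linarith
  with p(1) that show thesis by blast
qed

section \<open>Parseval's identity from Bessel's inequality and density\<close>

lemma nn_integral_count_space_infsum:
  fixes x :: "'i \<Rightarrow> real"
  assumes "\<And>n. 0 \<le> x n" "x summable_on UNIV"
  shows "(\<integral>\<^sup>+n. ennreal (x n) \<partial>count_space UNIV) = ennreal (infsum x UNIV)"
proof -
  have "Infinite_Set_Sum.abs_summable_on x UNIV"
    using assms by (simp add: abs_summable_equivalent[symmetric])
  then show ?thesis
    using assms by (simp add: nn_integral_conv_infsetsum infsetsum_infsum)
qed

lemma parseval:
  assumes f: "sq_int f"
  shows "(\<integral>\<^sup>+n. ennreal ((norm (fc f n))\<^sup>2) \<partial>count_space UNIV) * ennreal (2 * pi) = (\<integral>\<^sup>+t. ennreal ((norm (f t))\<^sup>2) \<partial>circ)"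
proof -
  define E where "E = (LINT t|circ. (norm (f t))\<^sup>2)"
  have bessel: "(\<Sum>n\<in>G. (norm (fc f n))\<^sup>2) \<le> E / (2 * pi)" if "finite G" for G
    using gap_nonneg[OF that f] by (simp add: gap_def E_def field_simps)
  have dense: "\<exists>G. finite G \<and> E / (2 * pi) - e < (\<Sum>n\<in>G. (norm (fc f n))\<^sup>2)" if "e > 0" for e
  proof -
    have "2 * pi * e > 0" using that by simp
    then obtain p where p: "trig_poly p" "(LINT t|circ. (norm (f t - p t))\<^sup>2) < 2 * pi * e"
      using trig_poly_dense[OF f] by metis
    obtain G where G: "finite G" "gap G (\<lambda>t. f t - p t) = gap G f"
      using trig_poly_gap[OF p(1)] f by metis
    \<comment> \<open>The gap of f equals that of f - p, which is at most the squared norm of f - p;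
      thus some finite sum comes within e of the upper bound given by Bessel's inequality.\<close>
    have "gap G f \<le> (LINT t|circ. (norm (f t - p t))\<^sup>2)"
      unfolding G(2)[symmetric] by (simp add: gap_def sum_nonneg)
    then have "E - 2 * pi * (\<Sum>n\<in>G. (norm (fc f n))\<^sup>2) < 2 * pi * e"
      using p(2) by (simp add: gap_def E_def)
    then show ?thesis using G(1) by (intro exI[of _ G]) (simp add: field_simps)
  qed
  have "((\<lambda>n. (norm (fc f n))\<^sup>2) has_sum (E / (2 * pi))) UNIV"
    unfolding has_sum_def
  proof (rule order_tendstoI)
    fix a assume "a < E / (2 * pi)"
    then obtain G where G: "finite G" "a < (\<Sum>n\<in>G. (norm (fc f n))\<^sup>2)"
      using dense[of "E / (2 * pi) - a"] by auto
    show "eventually (\<lambda>F. a < (\<Sum>n\<in>F. (norm (fc f n))\<^sup>2)) (finite_subsets_at_top UNIV)"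
      unfolding eventually_finite_subsets_at_top
      using G by (intro exI[of _ G]) (auto elim!: less_le_trans intro!: sum_mono2)
  next
    fix a assume "E / (2 * pi) < a"
    then show "eventually (\<lambda>F. (\<Sum>n\<in>F. (norm (fc f n))\<^sup>2) < a) (finite_subsets_at_top UNIV)"
      using bessel by (intro eventually_finite_subsets_at_top_weakI) (auto intro: le_less_trans)
  qed
  then have "(\<integral>\<^sup>+n. ennreal ((norm (fc f n))\<^sup>2) \<partial>count_space UNIV) = ennreal (E / (2 * pi))"
    by (subst nn_integral_count_space_infsum) (auto simp: summable_on_def infsumI)
  then have "(\<integral>\<^sup>+n. ennreal ((norm (fc f n))\<^sup>2) \<partial>count_space UNIV) * ennreal (2 * pi) = ennreal E"
    by (simp add: ennreal_mult''[symmetric] E_def)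
  also have "\<dots> = (\<integral>\<^sup>+t. ennreal ((norm (f t))\<^sup>2) \<partial>circ)"
    unfolding E_def using f by (intro nn_integral_eq_integral[symmetric]) (auto simp: sq_int_def)
  finally show ?thesis .
qed

subsection \<open>The double integral on the Fourier side\<close>

lemma lebesgue_on_circ:
  fixes F G :: "real \<Rightarrow> 'b::{banach, second_countable_topology}"
  assumes F: "F \<in> borel_measurable (lebesgue_on {-pi..pi})" and G: "G \<in> borel_measurable borel"
    and eq: "AE t in lborel. t \<in> {-pi..pi} \<longrightarrow> F t = G t"
  shows "integrable (lebesgue_on {-pi..pi}) F \<longleftrightarrow> integrable circ G"
    and "integral\<^sup>L (lebesgue_on {-pi..pi}) F = integral\<^sup>L circ G"
proof -
  have 1: "(\<lambda>t. indicator {-pi..pi} t *\<^sub>R F t) \<in> borel_measurable lebesgue"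
    using F by (simp add: borel_measurable_restrict_space_iff)
  have 2: "(\<lambda>t. indicator {-pi..<pi} t *\<^sub>R G t) \<in> borel_measurable lborel"
    using G by simp
  have 3: "AE t in lebesgue. indicator {-pi..pi} t *\<^sub>R F t = indicator {-pi..<pi} t *\<^sub>R G t"
  proof (rule AE_completion)
    show "AE t in lborel. indicator {-pi..pi} t *\<^sub>R F t = indicator {-pi..<pi} t *\<^sub>R G t"
      using eq AE_lborel_singleton[of pi] by eventually_elim (auto simp: indicator_def)
  qed
  have m2: "(\<lambda>t. indicator {-pi..<pi} t *\<^sub>R G t) \<in> borel_measurable lebesgue"
    using 2 by (rule measurable_completion)
  show "integrable (lebesgue_on {-pi..pi}) F \<longleftrightarrow> integrable circ G"
    using integrable_cong_AE[OF 1 m2 3] integrable_completion[OF 2]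
    by (simp add: integrable_restrict_space)
  show "integral\<^sup>L (lebesgue_on {-pi..pi}) F = integral\<^sup>L circ G"
    using integral_cong_AE[OF 1 m2 3] integral_completion[OF 2]
    by (simp add: integral_restrict_space)
qed

text \<open>\<open>G\<close> is arbitrary, since completing the measure does not change a
  nonnegative integral. The lemma thus applies to the double integral as it stands, before its
  integrand is replaced by a measurable one.\<close>

lemma nn_integral_lebesgue_on_circ:
  "(\<integral>\<^sup>+t. G t \<partial>lebesgue_on {-pi..pi}) = (\<integral>\<^sup>+t. G t \<partial>circ)"
proof -
  have "(\<integral>\<^sup>+t. G t \<partial>lebesgue_on {-pi..pi}) = (\<integral>\<^sup>+t. G t * indicator {-pi..pi} t \<partial>lborel)"
    by (simp add: nn_integral_restrict_space nn_integral_completion)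
  also have "\<dots> = (\<integral>\<^sup>+t. G t * indicator {-pi..<pi} t \<partial>lborel)"
  proof (rule nn_integral_cong_AE)
    show "AE t in lborel. G t * indicator {-pi..pi} t = G t * indicator {-pi..<pi} t"
      using AE_lborel_singleton[of pi] by eventually_elim (auto simp: indicator_def)
  qed
  finally show ?thesis by (simp add: nn_integral_restrict_space)
qed

section \<open>Reduction modulo 2 pi and rotation invariance\<close>

definition wrap :: "real \<Rightarrow> real" where
  "wrap x = x - 2 * pi * of_int \<lfloor>(x + pi) / (2 * pi)\<rfloor>"

lemma wrap_measurable [measurable]: "wrap \<in> borel_measurable borel"
  unfolding wrap_def[abs_def] by measurable

lemma wrap_bounds: "wrap x \<in> {-pi..<pi}"
proof -
  define k where "k = real_of_int \<lfloor>(x + pi) / (2 * pi)\<rfloor>"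
  have "k \<le> (x + pi) / (2 * pi)" "(x + pi) / (2 * pi) < k + 1"
    unfolding k_def by linarith+
  then have "k * (2 * pi) \<le> x + pi" "x + pi < (k + 1) * (2 * pi)"
    using pos_le_divide_eq[of "2 * pi" k "x + pi"] pos_divide_less_eq[of "2 * pi" "x + pi" "k + 1"] by simp_all
  moreover have "wrap x = x - k * (2 * pi)" by (simp add: wrap_def k_def mult.commute)
  ultimately show ?thesis by (simp add: distrib_right)
qed

lemma wrap_id: "x \<in> {-pi..<pi} \<Longrightarrow> wrap x = x"
proof -
  assume "x \<in> {-pi..<pi}"
  then have "\<lfloor>(x + pi) / (2 * pi)\<rfloor> = 0" by (simp add: floor_eq_iff field_simps)
  then show ?thesis by (simp add: wrap_def)
qed

lemma wrap_periodic: "wrap (x + 2 * pi) = wrap x"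
proof -
  have "(x + 2 * pi + pi) / (2 * pi) = (x + pi) / (2 * pi) + 1" by (simp add: field_simps)
  then have "\<lfloor>(x + 2 * pi + pi) / (2 * pi)\<rfloor> = \<lfloor>(x + pi) / (2 * pi)\<rfloor> + 1" by simp
  then show ?thesis by (simp add: wrap_def algebra_simps)
qed

lemma periodic_of_int:
  assumes "\<And>x. \<phi> (x + 2 * pi) = \<phi> x"
  shows "\<phi> (x + 2 * pi * of_int k) = \<phi> x"
proof (induction k rule: int_induct[where k = 0])
  case (step1 i)
  then show ?case using assms[of "x + 2 * pi * of_int i"] by (simp add: algebra_simps)
next
  case (step2 i)
  then show ?case using assms[of "x + 2 * pi * of_int (i - 1)"] by (simp add: algebra_simps)
qed simp

lemma periodic_wrap:
  assumes "\<And>x. \<phi> (x + 2 * pi) = \<phi> x"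
  shows "\<phi> (wrap x) = \<phi> x"
  using periodic_of_int[of \<phi> x "- \<lfloor>(x + pi) / (2 * pi)\<rfloor>"] assms by (simp add: wrap_def)

text \<open>With \<open>t\<close> replaced by its representative r in [0, 2 pi), the window [r - pi,
  r + pi) is cut at pi, and the piece to the right is moved back by one period to fill [-pi, r -
  pi).\<close>

lemma nn_integral_periodic_shift:
  assumes [measurable]: "\<phi> \<in> borel_measurable borel" and per: "\<And>x. \<phi> (x + 2 * pi) = (\<phi> x :: ennreal)"
  shows "(\<integral>\<^sup>+x. \<phi> (t + x) \<partial>circ) = (\<integral>\<^sup>+x. \<phi> x \<partial>circ)"
proof -
  define r where "r = wrap (t - pi) + pi"
  have r: "0 \<le> r" "r < 2 * pi" using wrap_bounds[of "t - pi"] by (auto simp: r_def)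
  define k where "k = \<lfloor>t / (2 * pi)\<rfloor>"
  have tr: "t = r + 2 * pi * of_int k" by (simp add: r_def k_def wrap_def)
  have \<phi>t: "\<phi> (t + x) = \<phi> (r + x)" for x
    using periodic_of_int[of \<phi> "r + x" k] per by (simp add: tr algebra_simps)
  have sh: "(\<integral>\<^sup>+x. g x \<partial>lborel) = (\<integral>\<^sup>+x. g (a + x) \<partial>lborel)" if "g \<in> borel_measurable borel" for g :: "real \<Rightarrow> ennreal" and a
    using nn_integral_real_affine[OF that, of 1 a] by simp
  have "(\<integral>\<^sup>+x. \<phi> (t + x) \<partial>circ) = (\<integral>\<^sup>+x. \<phi> (r + x) * indicator {-pi..<pi} x \<partial>lborel)"
    by (simp add: nn_integral_restrict_space \<phi>t)
  also have "\<dots> = (\<integral>\<^sup>+x. \<phi> x * indicator {r-pi..<r+pi} x \<partial>lborel)"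
    by (subst (2) sh[of _ r]) (auto intro!: nn_integral_cong simp: indicator_def)
  also have "\<dots> = (\<integral>\<^sup>+x. \<phi> x * indicator {r-pi..<pi} x + \<phi> x * indicator {pi..<r+pi} x \<partial>lborel)"
    using r by (intro nn_integral_cong) (auto simp: indicator_def)
  also have "\<dots> = (\<integral>\<^sup>+x. \<phi> x * indicator {r-pi..<pi} x \<partial>lborel) + (\<integral>\<^sup>+x. \<phi> x * indicator {pi..<r+pi} x \<partial>lborel)"
    by (intro nn_integral_add) auto
  also have "(\<integral>\<^sup>+x. \<phi> x * indicator {pi..<r+pi} x \<partial>lborel) = (\<integral>\<^sup>+x. \<phi> x * indicator {-pi..<r-pi} x \<partial>lborel)"
    by (subst sh[of _ "2 * pi"]) (auto intro!: nn_integral_cong simp: indicator_def per add.commute[of "2 * pi"])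
  also have "(\<integral>\<^sup>+x. \<phi> x * indicator {r-pi..<pi} x \<partial>lborel) + (\<integral>\<^sup>+x. \<phi> x * indicator {-pi..<r-pi} x \<partial>lborel)
     = (\<integral>\<^sup>+x. \<phi> x * indicator {r-pi..<pi} x + \<phi> x * indicator {-pi..<r-pi} x \<partial>lborel)"
    by (intro nn_integral_add[symmetric]) auto
  also have "\<dots> = (\<integral>\<^sup>+x. \<phi> x * indicator {-pi..<pi} x \<partial>lborel)"
    using r by (intro nn_integral_cong) (auto simp: indicator_def)
  finally show ?thesis by (simp add: nn_integral_restrict_space)
qed

lemma circ_id_measurable: "(\<lambda>x. x) \<in> circ \<rightarrow>\<^sub>M borel"
  by (rule measurable_restrict_space1) simp

lemma wrap_shift_measurable: "(\<lambda>x. wrap (t + x)) \<in> circ \<rightarrow>\<^sub>M circ"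
proof (rule measurable_restrict_space2)
  show "(\<lambda>x. wrap (t + x)) \<in> circ \<rightarrow>\<^sub>M lborel"
    by (rule measurable_restrict_space1) simp
qed (use wrap_bounds in blast)

text \<open>Rotation invariance as an identity of measures, obtained from nonnegative integrals of
  indicators. In this form it also transports integrability and integrals of vector-valued
  functions.\<close>

lemma distr_wrap_shift: "distr circ circ (\<lambda>x. wrap (t + x)) = circ"
proof (rule measure_eqI)
  fix A assume "A \<in> sets (distr circ circ (\<lambda>x. wrap (t + x)))"
  then have A: "A \<in> sets circ" by simp
  then have Ab: "A \<in> sets borel" "A \<subseteq> {-pi..<pi}"
    by (auto simp: sets_restrict_space_iff)
  have [measurable]: "A \<in> sets borel" by (rule Ab)
  have "emeasure (distr circ circ (\<lambda>x. wrap (t + x))) A = (\<integral>\<^sup>+x. indicator A x \<partial>distr circ circ (\<lambda>x. wrap (t + x)))"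
    using A by simp
  also have "\<dots> = (\<integral>\<^sup>+x. indicator A (wrap (t + x)) \<partial>circ)"
    using A by (intro nn_integral_distr wrap_shift_measurable) auto
  also have "\<dots> = (\<integral>\<^sup>+x. indicator A (wrap x) \<partial>circ)"
    by (rule nn_integral_periodic_shift) (auto simp: wrap_periodic)
  also have "\<dots> = (\<integral>\<^sup>+x. indicator A x \<partial>circ)"
    by (intro nn_integral_cong) (simp add: wrap_id space_restrict_space)
  also have "\<dots> = emeasure circ A" using A by simp
  finally show "emeasure (distr circ circ (\<lambda>x. wrap (t + x))) A = emeasure circ A" .
qed simp

lemma periodic_shift_circ:
  fixes \<phi> :: "real \<Rightarrow> 'b::{banach, second_countable_topology}"
  assumes [measurable]: "\<phi> \<in> borel_measurable borel" and per: "\<And>x. \<phi> (x + 2 * pi) = \<phi> x"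
  shows "(LINT x|circ. \<phi> (t + x)) = (LINT x|circ. \<phi> x)"
    and "integrable circ (\<lambda>x. \<phi> (t + x)) \<longleftrightarrow> integrable circ \<phi>"
proof -
  have "\<phi> (wrap x) = \<phi> x" for x using periodic_wrap[of \<phi>] per by blast
  then show "(LINT x|circ. \<phi> (t + x)) = (LINT x|circ. \<phi> x)"
    using integral_distr[OF wrap_shift_measurable, of \<phi> t] by (simp add: distr_wrap_shift measurable_circI)
  show "integrable circ (\<lambda>x. \<phi> (t + x)) \<longleftrightarrow> integrable circ \<phi>"
    using integrable_distr_eq[OF wrap_shift_measurable, of \<phi> t] \<open>\<And>x. \<phi> (wrap x) = \<phi> x\<close>
    by (simp add: distr_wrap_shift measurable_circI)
qed

text \<open>The infimum is attained at the floor that defines \<open>wrap\<close>: any other k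
  displaces a point of [-pi, pi) by at least 2 pi and so to absolute value at least pi.\<close>

lemma arc_dist_wrap: "arc_dist s t = \<bar>wrap (s - t)\<bar>"
proof -
  define k0 where "k0 = \<lfloor>(s - t + pi) / (2 * pi)\<rfloor>"
  have w: "wrap (s - t) = s - t - 2 * pi * of_int k0" by (simp add: wrap_def k0_def)
  have "\<bar>wrap (s - t)\<bar> \<le> \<bar>s - t - 2 * pi * of_int k\<bar>" for k
  proof (cases "k = k0")
    case True
    then show ?thesis using w by simp
  next
    case False
    define j where "j = real_of_int (k - k0)"
    have "\<bar>j\<bar> \<ge> 1" using False by (simp add: j_def)
    then have "2 * pi * \<bar>j\<bar> \<ge> 2 * pi" by simp
    then have "\<bar>2 * pi * j\<bar> \<ge> 2 * pi" by (simp add: abs_mult)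
    moreover have "s - t - 2 * pi * of_int k = wrap (s - t) - 2 * pi * j"
      by (simp add: w j_def algebra_simps)
    ultimately show ?thesis using wrap_bounds[of "s - t"] by auto
  qed
  moreover have "\<bar>wrap (s - t)\<bar> \<in> range (\<lambda>k. \<bar>s - t - 2 * pi * of_int k\<bar>)" using w by auto
  ultimately show ?thesis unfolding arc_dist_def
    by (intro cInf_eq_minimum) auto
qed

text \<open>Real and imaginary part agree almost everywhere with Borel functions, and composition
  with \<open>wrap\<close> makes these periodic. The point pi, which \<open>wrap\<close> sends to
  -pi, is sacrificed to the null set.\<close>

lemma borel_periodic_version:
  fixes F :: "complex \<Rightarrow> complex"
  assumes "(\<lambda>t. F (cis t)) \<in> borel_measurable (lebesgue_on {-pi..pi})"
  obtains p where "p \<in> borel_measurable borel" "\<And>t. p (t + 2 * pi) = p t"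
    "AE t in lborel. t \<in> {-pi..pi} \<longrightarrow> F (cis t) = p t"
proof -
  define G where "G t = indicator {-pi..pi} t *\<^sub>R F (cis t)" for t
  have G: "G \<in> borel_measurable lebesgue"
    using assms unfolding G_def by (simp add: borel_measurable_restrict_space_iff)
  obtain a where a: "a \<in> borel_measurable lborel" "AE t in lborel. Re (G t) = a t"
    using completion_ex_borel_measurable_real[of "\<lambda>t. Re (G t)" lborel] G by auto
  obtain b where b: "b \<in> borel_measurable lborel" "AE t in lborel. Im (G t) = b t"
    using completion_ex_borel_measurable_real[of "\<lambda>t. Im (G t)" lborel] G by auto
  have [measurable]: "a \<in> borel_measurable borel" "b \<in> borel_measurable borel" using a b by auto
  define p where "p t = Complex (a (wrap t)) (b (wrap t))" for t
  show thesis
  proof (rule that[of p])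
    show "p \<in> borel_measurable borel"
      unfolding p_def Complex_eq by measurable
    show "p (t + 2 * pi) = p t" for t by (simp add: p_def wrap_periodic)
    show "AE t in lborel. t \<in> {-pi..pi} \<longrightarrow> F (cis t) = p t"
      using a(2) b(2) AE_lborel_singleton[of pi]
    proof eventually_elim
      case (elim t)
      then show ?case by (auto simp: p_def wrap_id G_def complex_eq_iff)
    qed
  qed
qed

section \<open>Translates and the exchange of integrals and sum\<close>

lemma fc_shift_diff:
  assumes p: "sq_int p" and per: "\<And>t. p (t + 2 * pi) = p t"
  shows "sq_int (\<lambda>t. p (t + u) - p t)"
    and "fc (\<lambda>t. p (t + u) - p t) n = (cis (of_int n * u) - 1) * fc p n"
proof -
  have [measurable]: "p \<in> borel_measurable borel" using p by (simp add: sq_int_def)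
  have pu: "sq_int (\<lambda>t. p (t + u))"
    using p periodic_shift_circ(2)[of "\<lambda>t. (norm (p t))\<^sup>2" u] per
    by (auto simp: sq_int_def add.commute)
  show "sq_int (\<lambda>t. p (t + u) - p t)" by (rule sq_int_diff[OF pu p])
  have "(LINT t|circ. p (t + u) * cis (- of_int n * t)) = (LINT t|circ. cis (of_int n * u) * (p (u + t) * cis (- of_int n * (u + t))))"
  proof (intro Bochner_Integration.integral_cong refl)
    fix t
    have "cis (of_int n * u) * cis (- of_int n * (u + t)) = cis (- of_int n * t)"
      by (simp add: cis_mult algebra_simps)
    then show "p (t + u) * cis (- of_int n * t) = cis (of_int n * u) * (p (u + t) * cis (- of_int n * (u + t)))"
      by (simp add: add.commute mult.left_commute)
  qed
  also have "\<dots> = cis (of_int n * u) * (LINT t|circ. p (u + t) * cis (- of_int n * (u + t)))"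
    by (rule integral_mult_right_zero)
  also have "(LINT t|circ. p (u + t) * cis (- of_int n * (u + t))) = (LINT t|circ. p t * cis (- of_int n * t))"
  proof (rule periodic_shift_circ(1))
    fix x
    have "cis (- of_int n * (x + 2 * pi)) = cis (- of_int n * x) * cis (of_int (- n) * (2 * pi))"
      by (simp add: cis_mult algebra_simps)
    also have "cis (of_int (- n) * (2 * pi)) = 1"
      using cis_multiple_2pi[of "of_int (- n)"] by (simp add: mult_ac)
    finally show "p (x + 2 * pi) * cis (- of_int n * (x + 2 * pi)) = p x * cis (- of_int n * x)"
      by (simp add: per)
  qed measurable
  finally have "fc (\<lambda>t. p (t + u)) n = cis (of_int n * u) * fc p n" by (simp add: fc_def)
  then show "fc (\<lambda>t. p (t + u) - p t) n = (cis (of_int n * u) - 1) * fc p n"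
    by (simp add: fc_diff[OF pu p] algebra_simps)
qed

lemma norm_cis_minus_one: "(norm (cis y - 1))\<^sup>2 = 4 * (sin (y / 2))\<^sup>2"
proof -
  have "(norm (cis y - 1))\<^sup>2 = (cos y - 1)\<^sup>2 + (sin y)\<^sup>2" by (simp add: cmod_power2)
  also have "\<dots> = 2 - 2 * cos y" using sin_cos_squared_add[of y] by (simp add: power2_eq_square algebra_simps)
  also have "cos y = 1 - 2 * (sin (y / 2))\<^sup>2" using cos_double_sin[of "y / 2"] by simp
  finally show ?thesis by simp
qed

text \<open>In the inner integral s = t + u by rotation invariance; after the exchange,
  \<open>u\<close> is fixed and Parseval's identity applies in \<open>t\<close>. Since
  \<open>K\<close> has values in \<open>ennreal\<close>, a kernel that is not integrable at 0 is
  allowed.\<close>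

lemma double_integral_periodic:
  assumes p: "sq_int p" and per: "\<And>t. p (t + 2 * pi) = p t"
    and K [measurable]: "K \<in> borel_measurable borel" and Kper: "\<And>t. K (t + 2 * pi) = (K t :: ennreal)"
  shows "(\<integral>\<^sup>+t. \<integral>\<^sup>+s. ennreal ((norm (p t - p s))\<^sup>2) * K (s - t) \<partial>circ \<partial>circ)
    = (\<integral>\<^sup>+n. ennreal ((norm (fc p n))\<^sup>2) * (ennreal (2 * pi) * (\<integral>\<^sup>+u. ennreal (4 * (sin (of_int n * u / 2))\<^sup>2) * K u \<partial>circ)) \<partial>count_space UNIV)"
proof -
  have [measurable]: "p \<in> borel_measurable borel" using p by (simp add: sq_int_def)
  have [measurable]: "K \<in> borel_measurable circ" by (rule measurable_circI) simp
  interpret finite_measure circ by (rule finite_measure_circ)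
  interpret pair_sigma_finite circ circ by standard
  have "(\<integral>\<^sup>+t. \<integral>\<^sup>+s. ennreal ((norm (p t - p s))\<^sup>2) * K (s - t) \<partial>circ \<partial>circ)
    = (\<integral>\<^sup>+t. \<integral>\<^sup>+u. ennreal ((norm (p (t + u) - p t))\<^sup>2) * K u \<partial>circ \<partial>circ)"
  proof (rule nn_integral_cong)
    fix t
    have "K (x + 2 * pi - t) = K (x - t)" for x using Kper[of "x - t"] by (simp add: algebra_simps)
    then have "(\<integral>\<^sup>+s. ennreal ((norm (p t - p s))\<^sup>2) * K (s - t) \<partial>circ)
      = (\<integral>\<^sup>+u. ennreal ((norm (p t - p (t + u)))\<^sup>2) * K (t + u - t) \<partial>circ)"
      by (intro nn_integral_periodic_shift[symmetric]) (auto simp: per)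
    then show "(\<integral>\<^sup>+s. ennreal ((norm (p t - p s))\<^sup>2) * K (s - t) \<partial>circ)
      = (\<integral>\<^sup>+u. ennreal ((norm (p (t + u) - p t))\<^sup>2) * K u \<partial>circ)"
      by (simp add: norm_minus_commute)
  qed
  also have "\<dots> = (\<integral>\<^sup>+u. \<integral>\<^sup>+t. ennreal ((norm (p (t + u) - p t))\<^sup>2) * K u \<partial>circ \<partial>circ)"
  proof (rule Fubini'[symmetric])
    have [measurable]: "fst \<in> circ \<Otimes>\<^sub>M circ \<rightarrow>\<^sub>M borel" "snd \<in> circ \<Otimes>\<^sub>M circ \<rightarrow>\<^sub>M borel"
      using measurable_compose[OF measurable_fst circ_id_measurable] measurable_compose[OF measurable_snd circ_id_measurable]
      by auto
    show "(\<lambda>(t, u). ennreal ((norm (p (t + u) - p t))\<^sup>2) * K u) \<in> borel_measurable (circ \<Otimes>\<^sub>M circ)"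
      unfolding split_beta by measurable
  qed
  also have "\<dots> = (\<integral>\<^sup>+u. \<integral>\<^sup>+n. ennreal (4 * (sin (of_int n * u / 2))\<^sup>2) * ennreal ((norm (fc p n))\<^sup>2) * ennreal (2 * pi) * K u \<partial>count_space UNIV \<partial>circ)"
  proof (rule nn_integral_cong)
    fix u
    have "(\<integral>\<^sup>+t. ennreal ((norm (p (t + u) - p t))\<^sup>2) * K u \<partial>circ) = (\<integral>\<^sup>+t. ennreal ((norm (p (t + u) - p t))\<^sup>2) \<partial>circ) * K u"
      by (intro nn_integral_multc measurable_circI) measurable
    also have "(\<integral>\<^sup>+t. ennreal ((norm (p (t + u) - p t))\<^sup>2) \<partial>circ)
       = (\<integral>\<^sup>+n. ennreal ((norm (fc (\<lambda>t. p (t + u) - p t) n))\<^sup>2) \<partial>count_space UNIV) * ennreal (2 * pi)"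
      by (rule parseval[symmetric]) (rule fc_shift_diff[OF p per])
    also have "(\<integral>\<^sup>+n. ennreal ((norm (fc (\<lambda>t. p (t + u) - p t) n))\<^sup>2) \<partial>count_space UNIV)
      = (\<integral>\<^sup>+n. ennreal (4 * (sin (of_int n * u / 2))\<^sup>2) * ennreal ((norm (fc p n))\<^sup>2) \<partial>count_space UNIV)"
      by (simp only: fc_shift_diff(2)[OF p per] norm_mult power_mult_distrib norm_cis_minus_one)
         (simp add: ennreal_mult)
    finally show "(\<integral>\<^sup>+t. ennreal ((norm (p (t + u) - p t))\<^sup>2) * K u \<partial>circ)
      = (\<integral>\<^sup>+n. ennreal (4 * (sin (of_int n * u / 2))\<^sup>2) * ennreal ((norm (fc p n))\<^sup>2) * ennreal (2 * pi) * K u \<partial>count_space UNIV)"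
      by (simp add: nn_integral_multc)
  qed
  also have "\<dots> = (\<integral>\<^sup>+n. \<integral>\<^sup>+u. ennreal (4 * (sin (of_int n * u / 2))\<^sup>2) * ennreal ((norm (fc p n))\<^sup>2) * ennreal (2 * pi) * K u \<partial>circ \<partial>count_space UNIV)"
    by (intro nn_integral_count_space_nn_integral measurable_circI) measurable
  also have "\<dots> = (\<integral>\<^sup>+n. ennreal ((norm (fc p n))\<^sup>2) * (ennreal (2 * pi) * (\<integral>\<^sup>+u. ennreal (4 * (sin (of_int n * u / 2))\<^sup>2) * K u \<partial>circ)) \<partial>count_space UNIV)"
  proof (rule nn_integral_cong)
    fix n :: int
    have "(\<integral>\<^sup>+u. ennreal (4 * (sin (of_int n * u / 2))\<^sup>2) * ennreal ((norm (fc p n))\<^sup>2) * ennreal (2 * pi) * K u \<partial>circ)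
      = (\<integral>\<^sup>+u. (ennreal ((norm (fc p n))\<^sup>2) * ennreal (2 * pi)) * (ennreal (4 * (sin (of_int n * u / 2))\<^sup>2) * K u) \<partial>circ)"
      by (intro nn_integral_cong) (simp add: mult_ac)
    also have "\<dots> = (ennreal ((norm (fc p n))\<^sup>2) * ennreal (2 * pi)) * (\<integral>\<^sup>+u. ennreal (4 * (sin (of_int n * u / 2))\<^sup>2) * K u \<partial>circ)"
      by (intro nn_integral_cmult measurable_circI) measurable
    finally show "(\<integral>\<^sup>+u. ennreal (4 * (sin (of_int n * u / 2))\<^sup>2) * ennreal ((norm (fc p n))\<^sup>2) * ennreal (2 * pi) * K u \<partial>circ)
      = ennreal ((norm (fc p n))\<^sup>2) * (ennreal (2 * pi) * (\<integral>\<^sup>+u. ennreal (4 * (sin (of_int n * u / 2))\<^sup>2) * K u \<partial>circ))"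
      by (simp add: mult.assoc)
  qed
  finally show ?thesis .
qed

text \<open>The factor 8 pi is 4 from |e^(iy) - 1|^2 = 4 sin^2(y/2), 2 from the two halves of an
  even integrand, and pi from the substitution u = pi x.\<close>

lemma circ_even_integral:
  assumes [measurable]: "H \<in> borel_measurable borel"
  shows "(\<integral>\<^sup>+u. ennreal (4 * (sin (of_int n * u / 2))\<^sup>2) * H (\<bar>wrap u\<bar> / pi) \<partial>circ)
    = ennreal (8 * pi) * (\<integral>\<^sup>+x. ennreal ((sin (real (nat \<bar>n\<bar>) * pi * x / 2))\<^sup>2) * H x * indicator {0<..<1} x \<partial>lborel)"
proof -
  define \<phi> where "\<phi> u = ennreal (4 * (sin (of_int n * u / 2))\<^sup>2) * H (u / pi) * indicator {0<..<pi} u" for u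
  have [measurable]: "\<phi> \<in> borel_measurable borel" unfolding \<phi>_def by measurable
  have sq: "(sin (of_int n * \<bar>u\<bar> / 2))\<^sup>2 = (sin (of_int n * u / 2))\<^sup>2" for u :: real
    by (cases "u \<ge> 0") auto
  have sqn: "(sin (of_int n * (pi * x) / 2))\<^sup>2 = (sin (real (nat \<bar>n\<bar>) * pi * x / 2))\<^sup>2" for x
    by (cases "n \<ge> 0") (auto simp: mult_ac)
  have "(\<integral>\<^sup>+u. ennreal (4 * (sin (of_int n * u / 2))\<^sup>2) * H (\<bar>wrap u\<bar> / pi) \<partial>circ)
     = (\<integral>\<^sup>+u. ennreal (4 * (sin (of_int n * u / 2))\<^sup>2) * H (\<bar>wrap u\<bar> / pi) * indicator {-pi..<pi} u \<partial>lborel)"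
    by (simp add: nn_integral_restrict_space)
  also have "\<dots> = (\<integral>\<^sup>+u. \<phi> u + \<phi> (- u) \<partial>lborel)"
  proof (rule nn_integral_cong_AE)
    show "AE u in lborel. ennreal (4 * (sin (of_int n * u / 2))\<^sup>2) * H (\<bar>wrap u\<bar> / pi) * indicator {-pi..<pi} u = \<phi> u + \<phi> (- u)"
      using AE_lborel_singleton[of "-pi"] AE_lborel_singleton[of 0]
    proof eventually_elim
      case (elim u)
      show ?case
      proof (cases "u \<in> {-pi<..<pi}")
        case True
        then have "wrap u = u" by (intro wrap_id) auto
        then show ?thesis using True elim sq[of u]
          by (cases "u > 0") (auto simp: \<phi>_def)
      next
        case False
        then show ?thesis using elim by (auto simp: \<phi>_def indicator_def)
      qed
    qed
  qed
  also have "\<dots> = (\<integral>\<^sup>+u. \<phi> u \<partial>lborel) + (\<integral>\<^sup>+u. \<phi> (- u) \<partial>lborel)"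
    by (intro nn_integral_add) auto
  also have "(\<integral>\<^sup>+u. \<phi> (- u) \<partial>lborel) = (\<integral>\<^sup>+u. \<phi> u \<partial>lborel)"
    using nn_integral_real_affine[of \<phi> "-1" 0] by simp
  also have "(\<integral>\<^sup>+u. \<phi> u \<partial>lborel) = ennreal pi * (\<integral>\<^sup>+x. \<phi> (pi * x) \<partial>lborel)"
    by (subst nn_integral_real_affine[of \<phi> pi 0]) auto
  also have "(\<integral>\<^sup>+x. \<phi> (pi * x) \<partial>lborel) = (\<integral>\<^sup>+x. ennreal 4 * (ennreal ((sin (real (nat \<bar>n\<bar>) * pi * x / 2))\<^sup>2) * H x * indicator {0<..<1} x) \<partial>lborel)"
  proof (intro nn_integral_cong)
    fix x :: real
    have "pi * x < pi \<longleftrightarrow> x < 1" by simp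
    then have ind: "indicator {0<..<pi} (pi * x) = (indicator {0<..<1} x :: ennreal)"
      by (simp add: indicator_def zero_less_mult_iff)
    have "pi * x / pi = x" by simp
    then show "\<phi> (pi * x) = ennreal 4 * (ennreal ((sin (real (nat \<bar>n\<bar>) * pi * x / 2))\<^sup>2) * H x * indicator {0<..<1} x)"
      unfolding \<phi>_def sqn ind by (simp add: ennreal_mult' mult_ac del: ennreal_numeral)
  qed
  also have "\<dots> = ennreal 4 * (\<integral>\<^sup>+x. ennreal ((sin (real (nat \<bar>n\<bar>) * pi * x / 2))\<^sup>2) * H x * indicator {0<..<1} x \<partial>lborel)"
    by (intro nn_integral_cmult) measurable
  finally have "(\<integral>\<^sup>+u. ennreal (4 * (sin (of_int n * u / 2))\<^sup>2) * H (\<bar>wrap u\<bar> / pi) \<partial>circ)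
    = 2 * (ennreal pi * (ennreal 4 * (\<integral>\<^sup>+x. ennreal ((sin (real (nat \<bar>n\<bar>) * pi * x / 2))\<^sup>2) * H x * indicator {0<..<1} x \<partial>lborel)))"
    by (simp only: mult_2)
  also have "\<dots> = (2 * ennreal pi * ennreal 4) * (\<integral>\<^sup>+x. ennreal ((sin (real (nat \<bar>n\<bar>) * pi * x / 2))\<^sup>2) * H x * indicator {0<..<1} x \<partial>lborel)"
    by (simp only: mult.assoc)
  also have "2 * ennreal pi * ennreal 4 = ennreal (8 * pi)"
    by (simp add: ennreal_mult' mult_ac)
  finally show ?thesis .
qed

section \<open>From the given weight to the normalised one\<close>

lemma regular_weightI:
  fixes W :: "real \<Rightarrow> real"
  assumes W: "weight W" "cond_C1 W" "cond_C2 W" "cond_C3 W"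
  defines "V \<equiv> \<lambda>t. if 0 < t then W t else 0"
  obtains c where "regular_weight V c"
proof -
  obtain c where c: "0 < c" "c < 2" "\<And>t. 0 < t \<Longrightarrow> t < 1 \<Longrightarrow> W t \<le> c * W (t / 2)"
    using W(4) unfolding cond_C3_def by blast
  have nonneg: "0 \<le> W t" if "0 < t" "t \<le> 1" for t using W(1) that by (auto simp: weight_def)
  obtain W' where W': "\<And>t. t \<in> {0<..1} \<Longrightarrow> (W has_real_derivative W' t) (at t within {0<..1})"
    using W(1) unfolding weight_def by blast
  have "continuous_on {0<..1} W"
    by (rule DERIV_continuous_on[OF W'])
  then have cont: "continuous_on {0<..1} V"
    by (subst continuous_on_cong[OF refl]) (auto simp: V_def)
  have "W integrable_on {0<..1}"
    using W(1) by (intro integrable_on_lebesgue_on) (auto simp: weight_def)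
  then have "V integrable_on {0<..1}"
    by (subst Henstock_Kurzweil_Integration.integrable_cong[where g = W]) (auto simp: V_def)
  then have int: "V integrable_on {0..1}"
    by (rule integrable_spike_set) (auto intro: negligible_subset[of "{0}"])
  have mono: "mono_on {0<..1} V \<or> antimono_on {0<..1} V"
    using W(2) unfolding cond_C1_def monotone_on_def by (auto simp: V_def)
  \<comment> \<open>(C2) supplies a positive value: if \<open>W\<close> vanished on (0,1), the
    integral of W(t)/t would be 0 instead of infinite.\<close>
  have nontriv: "\<exists>t. 0 < t \<and> t < 1 \<and> 0 < V t"
  proof (rule ccontr)
    assume "\<not> ?thesis"
    then have z: "W t = 0" if "0 < t" "t < 1" for t
      using that nonneg[of t] by (force simp: V_def)
    have "(\<integral>\<^sup>+ t. ennreal (W t / t) \<partial>lebesgue_on {0<..1}) = (\<integral>\<^sup>+ t. ennreal (W t / t) * indicator {0<..1} t \<partial>lborel)"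
      by (simp add: nn_integral_restrict_space nn_integral_completion)
    also have "\<dots> = (\<integral>\<^sup>+ t. 0 \<partial>(lborel :: real measure))"
    proof (rule nn_integral_cong_AE)
      show "AE t in lborel. ennreal (W t / t) * indicator {0<..1} t = 0"
        using AE_lborel_singleton[of 1] by eventually_elim (auto simp: indicator_def z)
    qed
    finally show False using W(3) by (simp add: cond_C2_def)
  qed
  have "regular_weight V (max c 1)"
  proof
    fix t :: real assume t: "0 < t" "t < 1"
    have "V t \<le> c * V (t / 2)" using c(3)[OF t] t by (simp add: V_def)
    also have "\<dots> \<le> max c 1 * V (t / 2)" using nonneg[of "t / 2"] t by (intro mult_right_mono) (auto simp: V_def)
    finally show "V t \<le> max c 1 * V (t / 2)" .
  qed (use c nonneg cont int mono nontriv in \<open>auto simp: V_def\<close>)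
  then show thesis by (rule that)
qed

lemma h_kernel_eq:
  assumes "integrable (lebesgue_on {0<..1}) W"
    and "regular_weight (\<lambda>t. if 0 < t then W t else 0) c" and t: "0 \<le> t" "t \<le> 1"
  shows "h_kernel W t = regular_weight.h (\<lambda>t. if 0 < t then W t else 0) t"
proof -
  let ?V = "\<lambda>t. if 0 < t then W t else 0"
  interpret regular_weight ?V c by fact
  have "set_integrable lebesgue {0<..1} W"
    using assms(1) by (simp add: set_integrable_def integrable_restrict_space)
  then have "set_integrable lebesgue {0<..t} W"
    by (rule set_integrable_subset) (use t in auto)
  then have "integrable (lebesgue_on {0<..t}) W"
    by (simp add: set_integrable_def integrable_restrict_space)
  then have "(LINT s|lebesgue_on {0<..t}. W s) = integral {0<..t} W"
    by (rule lebesgue_integral_eq_integral) simp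
  also have "\<dots> = integral {0<..t} ?V"
    by (rule Henstock_Kurzweil_Integration.integral_cong) auto
  also have "\<dots> = M t" unfolding M_def
    by (rule integral_spike_set) (auto intro: negligible_subset[of "{0}"])
  finally have "h_kernel W t = W t / (M t)\<^sup>2" by (simp add: h_kernel_def)
  \<comment> \<open>At t = 0 the value \<open>W 0\<close> is arbitrary, but the denominator is 0 on
    both sides, and division by 0 gives 0.\<close>
  then show ?thesis using t by (cases "t = 0") (auto simp: h_def M_def)
qed

lemma moment_eq:
  assumes "regular_weight (\<lambda>t. if 0 < t then W t else 0) c"
  shows "moment W n = regular_weight.\<omega> (\<lambda>t. if 0 < t then W t else 0) n"
proof -
  let ?V = "\<lambda>t. if 0 < t then W t else 0"
  interpret regular_weight ?V c by fact
  have "((\<lambda>t. (1 - t) ^ n * ?V t) has_integral \<omega> n) (cbox 0 1)"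
    unfolding \<omega>_def cbox_interval by (rule integrable_integral[OF power_W_integrable])
  from has_integral_affinity[OF this, of "-1" 1, unfolded real_scaleR_def]
  have "((\<lambda>r. (1 - (-1 * r + 1)) ^ n * ?V (-1 * r + 1)) has_integral \<omega> n) ((\<lambda>x. - x + 1) ` {0..1})" by simp
  also have "(\<lambda>x. - x + 1) ` {0..1::real} = {0..1}"
    by (auto simp: image_iff intro!: bexI[of _ "1 - x" for x])
  also have "(\<lambda>r. (1 - (-1 * r + 1)) ^ n * ?V (-1 * r + 1)) = (\<lambda>r. r ^ n * ?V (1 - r))"
    by (auto simp: fun_eq_iff)
  finally have "((\<lambda>r. r ^ n * ?V (1 - r)) has_integral \<omega> n) {0..1}" .
  then have 1: "((\<lambda>r. r ^ n * ?V (1 - r)) has_integral \<omega> n) {0..<1}"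
    by (subst has_integral_spike_set_eq[where T = "{0..1}"]) (auto intro: negligible_subset[of "{1}"])
  have "(\<lambda>r. r ^ n * ?V (1 - r)) absolutely_integrable_on {0..<1}"
  proof (rule nonnegative_absolutely_integrable_1)
    fix r :: real assume "r \<in> {0..<1}"
    then show "0 \<le> r ^ n * ?V (1 - r)" using W_nonneg[of "1 - r"] by simp
  qed (use 1 in blast)
  then have "integrable (lebesgue_on {0..<1}) (\<lambda>r. r ^ n * ?V (1 - r))"
    by (rule absolutely_integrable_imp_integrable) simp
  from lebesgue_integral_eq_integral[OF this]
  have "(LINT r|lebesgue_on {0..<1}. r ^ n * ?V (1 - r)) = \<omega> n" using 1 by (simp add: integral_unique)
  moreover have "moment W n = (LINT r|lebesgue_on {0..<1}. r ^ n * ?V (1 - r))"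
    unfolding moment_def by (intro Bochner_Integration.integral_cong) (auto simp: space_restrict_space)
  ultimately show ?thesis by simp
qed

lemma double_integral_eq:
  assumes W: "integrable (lebesgue_on {0<..1}) W"
    and V: "regular_weight (\<lambda>t. if 0 < t then W t else 0) c"
    and f: "f \<in> L2_circle"
  shows "double_integral W f =
    (\<integral>\<^sup>+n. ennreal ((norm (fourier_coeff f n))\<^sup>2) *
       (ennreal (16 * pi\<^sup>2) * regular_weight.S (\<lambda>t. if 0 < t then W t else 0) (nat \<bar>n\<bar>)) \<partial>count_space UNIV)"
proof -
  let ?V = "\<lambda>t. if 0 < t then W t else 0"
  interpret regular_weight ?V c by fact
  have fm: "(\<lambda>t. f (cis t)) \<in> borel_measurable (lebesgue_on {-pi..pi})" and
    fi: "integrable (lebesgue_on {-pi..pi}) (\<lambda>t. (norm (f (cis t)))\<^sup>2)"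
    using f by (auto simp: L2_circle_def)
  obtain p where p [measurable]: "p \<in> borel_measurable borel" and per: "\<And>t. p (t + 2 * pi) = p t"
    and fp: "AE t in lborel. t \<in> {-pi..pi} \<longrightarrow> f (cis t) = p t"
    by (rule borel_periodic_version[OF fm]) blast
  have fpc: "AE t in circ. f (cis t) = p t"
  proof (subst AE_restrict_space_iff)
    show "AE t in lborel. t \<in> {-pi..<pi} \<longrightarrow> f (cis t) = p t"
      using fp by eventually_elim auto
  qed simp
  have "integrable circ (\<lambda>t. (norm (p t))\<^sup>2)"
  proof (subst lebesgue_on_circ(1)[symmetric, where F = "\<lambda>t. (norm (f (cis t)))\<^sup>2"])
    show "AE t in lborel. t \<in> {-pi..pi} \<longrightarrow> (norm (f (cis t)))\<^sup>2 = (norm (p t))\<^sup>2"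
      using fp by eventually_elim auto
  qed (use fm fi in auto)
  then have sp: "sq_int p" by (simp add: sq_int_def)
  have fc: "fc p n = fourier_coeff f n" for n
  proof -
    have cm: "(\<lambda>t. cis (- of_int n * t)) \<in> borel_measurable (lebesgue_on {-pi..pi})"
      by (intro continuous_imp_measurable_on_sets_lebesgue continuous_intros) simp
    have "(LINT t|lebesgue_on {-pi..pi}. f (cis t) * cis (- of_int n * t)) = (LINT t|circ. p t * cis (- of_int n * t))"
    proof (rule lebesgue_on_circ(2))
      show "AE t in lborel. t \<in> {-pi..pi} \<longrightarrow> f (cis t) * cis (- of_int n * t) = p t * cis (- of_int n * t)"
        using fp by eventually_elim auto
      show "(\<lambda>t. f (cis t) * cis (- of_int n * t)) \<in> borel_measurable (lebesgue_on {-pi..pi})"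
        by (rule borel_measurable_times[OF fm cm])
    qed measurable
    then show ?thesis by (simp add: fc_def fourier_coeff_def)
  qed
  define H where "H x = ennreal (h x) * indicator {0<..1} x" for x
  have Hm [measurable]: "H \<in> borel_measurable borel" unfolding H_def by (rule h_borel)
  have hH: "ennreal (h_kernel W x) = H x" "0 \<le> h_kernel W x" if "0 \<le> x" "x \<le> 1" for x
    using h_kernel_eq[OF W V that] that h_nonneg[OF that] by (auto simp: H_def indicator_def h_def M_def)
  define K where "K u = H (\<bar>wrap u\<bar> / pi)" for u
  have Km: "K \<in> borel_measurable borel" unfolding K_def by measurable
  have Kp: "K (t + 2 * pi) = K t" for t by (simp add: K_def wrap_periodic)
  have "double_integral W f = (\<integral>\<^sup>+t. \<integral>\<^sup>+s. ennreal ((norm (f (cis t) - f (cis s)))\<^sup>2 * h_kernel W (arc_dist s t / pi)) \<partial>circ \<partial>circ)"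
    by (simp only: double_integral_def nn_integral_lebesgue_on_circ)
  also have "\<dots> = (\<integral>\<^sup>+t. \<integral>\<^sup>+s. ennreal ((norm (p t - p s))\<^sup>2) * K (s - t) \<partial>circ \<partial>circ)"
  \<comment> \<open>The integral is iterated, so \<open>f\<close> is exchanged for \<open>p\<close>
    one variable at a time: for almost every \<open>t\<close>, and then for almost every
    \<open>s\<close>.\<close>
  proof (rule nn_integral_cong_AE, use fpc in eventually_elim)
    fix t assume t: "f (cis t) = p t"
    show "(\<integral>\<^sup>+s. ennreal ((norm (f (cis t) - f (cis s)))\<^sup>2 * h_kernel W (arc_dist s t / pi)) \<partial>circ)
      = (\<integral>\<^sup>+s. ennreal ((norm (p t - p s))\<^sup>2) * K (s - t) \<partial>circ)"
    proof (rule nn_integral_cong_AE, use fpc in eventually_elim)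
      fix s assume s: "f (cis s) = p s"
      have "\<bar>wrap (s - t)\<bar> \<le> pi" using wrap_bounds[of "s - t"] by auto
      then have "ennreal (h_kernel W (arc_dist s t / pi)) = K (s - t)"
        unfolding K_def arc_dist_wrap by (intro hH) (auto simp: divide_le_eq)
      then show "ennreal ((norm (f (cis t) - f (cis s)))\<^sup>2 * h_kernel W (arc_dist s t / pi)) = ennreal ((norm (p t - p s))\<^sup>2) * K (s - t)"
        by (simp add: s t ennreal_mult')
    qed
  qed
  also have "\<dots> = (\<integral>\<^sup>+n. ennreal ((norm (fc p n))\<^sup>2) * (ennreal (2 * pi) * (\<integral>\<^sup>+u. ennreal (4 * (sin (of_int n * u / 2))\<^sup>2) * K u \<partial>circ)) \<partial>count_space UNIV)"
    by (rule double_integral_periodic[OF sp per Km Kp])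
  also have "\<dots> = (\<integral>\<^sup>+n. ennreal ((norm (fourier_coeff f n))\<^sup>2) * (ennreal (16 * pi\<^sup>2) * S (nat \<bar>n\<bar>)) \<partial>count_space UNIV)"
  proof (rule nn_integral_cong)
    fix n :: int
    have "(\<integral>\<^sup>+x. ennreal ((sin (real (nat \<bar>n\<bar>) * pi * x / 2))\<^sup>2) * H x * indicator {0<..<1} x \<partial>lborel) = S (nat \<bar>n\<bar>)"
      unfolding S_def by (intro nn_integral_cong) (auto simp: indicator_def H_def ennreal_mult')
    then have "(\<integral>\<^sup>+u. ennreal (4 * (sin (of_int n * u / 2))\<^sup>2) * K u \<partial>circ) = ennreal (8 * pi) * S (nat \<bar>n\<bar>)"
      using circ_even_integral[OF Hm, of n] by (simp add: K_def)
    \<comment> \<open>One factor 2 pi from Parseval's identity, the other 8 pi from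
      \<open>circ_even_integral\<close>.\<close>
    moreover have "ennreal (2 * pi) * (ennreal (8 * pi) * S (nat \<bar>n\<bar>)) = ennreal (16 * pi\<^sup>2) * S (nat \<bar>n\<bar>)"
    proof -
      have "ennreal (16 * pi\<^sup>2) = ennreal (2 * pi) * ennreal (8 * pi)"
        by (subst ennreal_mult'[symmetric]) (simp_all add: power2_eq_square)
      then show ?thesis by (simp only: mult.assoc)
    qed
    ultimately show "ennreal ((norm (fc p n))\<^sup>2) * (ennreal (2 * pi) * (\<integral>\<^sup>+u. ennreal (4 * (sin (of_int n * u / 2))\<^sup>2) * K u \<partial>circ))
      = ennreal ((norm (fourier_coeff f n))\<^sup>2) * (ennreal (16 * pi\<^sup>2) * S (nat \<bar>n\<bar>))"
      by (simp only: fc)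
  qed
  finally show ?thesis .
qed

theorem theorem3p4:
  fixes W :: "real \<Rightarrow> real" and \<omega> \<Omega> :: "nat \<Rightarrow> real"
  assumes "weight W" and "cond_C1 W" and "cond_C2 W" and "cond_C3 W"
    and "\<omega> = moment W"
    and "\<Omega> = (\<lambda>n. 1 / \<omega> n)"
  shows "\<exists>c1>0. \<exists>c2>0. \<forall>f\<in>weighted_l2 \<Omega>. fourier_coeff f 0 = 0 \<longrightarrow>
           ennreal (c1 * weighted_l2_normsq \<Omega> f) \<le> double_integral W f \<and>
           double_integral W f \<le> ennreal (c2 * weighted_l2_normsq \<Omega> f)"
proof -
  let ?V = "\<lambda>t. if 0 < t then W t else 0"
  obtain c where V: "regular_weight ?V c"
    using regular_weightI[OF assms(1-4)] by blast
  interpret V: regular_weight ?V c by (rule V)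
  have \<Omega>: "\<Omega> n = 1 / V.\<omega> n" for n
    by (simp add: assms(5,6) moment_eq[OF V])
  obtain c1 c2 where c: "c1 > 0" "c2 > 0"
    "\<And>n. n \<ge> 1 \<Longrightarrow> ennreal (c1 * \<Omega> n) \<le> V.S n" "\<And>n. n \<ge> 1 \<Longrightarrow> V.S n \<le> ennreal (c2 * \<Omega> n)"
    using V.S_asymp unfolding \<Omega> by blast
  have W: "integrable (lebesgue_on {0<..1}) W" using assms(1) by (simp add: weight_def)
  have "ennreal (16 * pi\<^sup>2 * c1 * weighted_l2_normsq \<Omega> f) \<le> double_integral W f \<and>
      double_integral W f \<le> ennreal (16 * pi\<^sup>2 * c2 * weighted_l2_normsq \<Omega> f)"
    if f: "f \<in> weighted_l2 \<Omega>" and f0: "fourier_coeff f 0 = 0" for f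
  proof -
    define x where "x n = (norm (fourier_coeff f n))\<^sup>2 * \<Omega> (nat \<bar>n\<bar>)" for n
    define y where "y n = ennreal ((norm (fourier_coeff f n))\<^sup>2) * (ennreal (16 * pi\<^sup>2) * V.S (nat \<bar>n\<bar>))" for n
    have D: "double_integral W f = (\<integral>\<^sup>+n. y n \<partial>count_space UNIV)"
      using f by (simp add: y_def weighted_l2_def double_integral_eq[OF W V])
    have n1: "nat \<bar>n\<bar> \<ge> 1" if "n \<noteq> 0" for n :: int using that by simp
    have xnn: "0 \<le> x n" for n
      using V.\<omega>_pos[OF n1, of n] f0 by (cases "n = 0") (auto simp: x_def \<Omega>)
    have xs: "x summable_on UNIV" using f by (simp add: weighted_l2_def x_def[abs_def])
    \<comment> \<open>Membership in the weighted space enters here: summability turns the extended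
      sum into the real number \<open>weighted_l2_normsq \<Omega> f\<close>.\<close>
    have X: "(\<integral>\<^sup>+n. ennreal (C * x n) \<partial>count_space UNIV) = ennreal (C * weighted_l2_normsq \<Omega> f)" if "C > 0" for C
      using that nn_integral_count_space_infsum[OF xnn xs]
      by (simp add: ennreal_mult' nn_integral_cmult weighted_l2_normsq_def x_def[abs_def])
    have e: "ennreal (16 * pi\<^sup>2 * C * x n) = ennreal ((norm (fourier_coeff f n))\<^sup>2) * (ennreal (16 * pi\<^sup>2) * ennreal (C * \<Omega> (nat \<bar>n\<bar>)))" for C n
    proof -
      have "16 * pi\<^sup>2 * C * x n = (norm (fourier_coeff f n))\<^sup>2 * (16 * pi\<^sup>2 * (C * \<Omega> (nat \<bar>n\<bar>)))"
        by (simp add: x_def)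
      then show ?thesis by (simp only: ennreal_mult' zero_le_power2 zero_le_mult_iff zero_le_numeral simp_thms)
    qed
    \<comment> \<open>The zero average settles n = 0, where no comparison is possible: S(0) = 0,
      since the sine vanishes, while \<Omega>(0) is positive.\<close>
    have "ennreal (16 * pi\<^sup>2 * c1 * x n) \<le> y n" for n
    proof (cases "n = 0")
      case False
      then show ?thesis unfolding e y_def by (intro mult_left_mono c(3) n1) auto
    qed (simp add: x_def f0)
    moreover have "y n \<le> ennreal (16 * pi\<^sup>2 * c2 * x n)" for n
    proof (cases "n = 0")
      case False
      then show ?thesis unfolding e y_def by (intro mult_left_mono c(4) n1) auto
    qed (simp add: y_def f0)
    ultimately show ?thesis
      unfolding D using X[of "16 * pi\<^sup>2 * c1"] X[of "16 * pi\<^sup>2 * c2"] c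
      by (metis (no_types, lifting) mult_pos_pos nn_integral_mono pi_gt_zero zero_less_numeral zero_less_power)
  qed
  then show ?thesis
    using c(1,2) by (intro exI[of _ "16 * pi\<^sup>2 * c1"] exI[of _ "16 * pi\<^sup>2 * c2"] conjI) auto
qed

end
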